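(* The class of $(P_1+\overline{2P_1+P_2})$-free chordal graphs has bounded clique-width.
   Context: All graphs are finite, simple and undirected. $G$ is $H$-free if it has no induced subgraph isomorphic to $H$. A graph is chordal if it contains no induced cycle $C_r$ with $r\geq 4$. $P_r$ is the path on $r$ vertices, $+$ denotes disjoint union and $\overline{G}$ the complement; $\overline{2P_1+P_2}$ is the diamond ($K_4$ minus one edge), so $P_1+\overline{2P_1+P_2}$ is the disjoint union of an isolated vertex and a diamond. The clique-width of a graph $G$ is the minimum number $k$ of labels needed to construct $G$ using the operations: create a single vertex with label $i$; take the disjoint union of two labelled graphs; add all edges between vertices of label $i$ and vertices of label $j$ ($i\neq j$); rename label $i$ to $j$. A class of graphs has bounded clique-width if there is a constant $c$ such that every graph in the class has clique-width at most $c$. *)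

theory Defs
  imports "Graph_Theory.Pair_Digraph" "Graph_Theory.Digraph_Component"
    "Graph_Theory.Digraph_Isomorphism"
begin

text \<open>
  A finite simple undirected graph is a \<^locale>\<open>pair_graph\<close>: finitely many vertices, no loops,
  and a symmetric arc set, so that an edge uv is the pair of arcs (u,v), (v,u).
\<close>

definition path_graph :: "nat \<Rightarrow> nat pair_pre_digraph" where
  "path_graph r = \<lparr> pverts = {..<r},
     parcs = {(i, j). i < r \<and> j < r \<and> (j = Suc i \<or> i = Suc j)} \<rparr>"

text \<open>Only meaningful for \<open>r \<ge> 3\<close>.\<close>
definition cycle_graph :: "nat \<Rightarrow> nat pair_pre_digraph" where
  "cycle_graph r = \<lparr> pverts = {..<r},
     parcs = {(i, j). i < r \<and> j < r \<and> (j = Suc i mod r \<or> i = Suc j mod r)} \<rparr>"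

definition complement_graph :: "'a pair_pre_digraph \<Rightarrow> 'a pair_pre_digraph" where
  "complement_graph G = \<lparr> pverts = pverts G,
     parcs = {(u, v). u \<in> pverts G \<and> v \<in> pverts G \<and> u \<noteq> v \<and> (u, v) \<notin> parcs G} \<rparr>"

definition disjoint_union ::
    "'a pair_pre_digraph \<Rightarrow> 'b pair_pre_digraph \<Rightarrow> ('a + 'b) pair_pre_digraph"
    (infixl \<open>+\<^sub>G\<close> 65) where
  "G +\<^sub>G H = \<lparr> pverts = pverts G <+> pverts H,
     parcs = map_prod Inl Inl ` parcs G \<union> map_prod Inr Inr ` parcs H \<rparr>"

definition H_free :: "'b pair_pre_digraph \<Rightarrow> 'a pair_pre_digraph \<Rightarrow> bool" where
  "H_free H G \<longleftrightarrow> \<not> (\<exists>K. induced_subgraph K (with_proj G) \<and> digraph_iso K (with_proj H))"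

definition chordal :: "'a pair_pre_digraph \<Rightarrow> bool" where
  "chordal G \<longleftrightarrow> (\<forall>r\<ge>4. H_free (cycle_graph r) G)"

text \<open>
  \<open>cw_constructs k G l\<close>: the graph \<open>G\<close>, with labelling \<open>l\<close> of its vertices, arises from the four
  clique-width operations with labels in \<open>{..<k}\<close>. The values of \<open>l\<close> outside \<open>pverts G\<close> are
  irrelevant.
\<close>
inductive cw_constructs :: "nat \<Rightarrow> 'a pair_pre_digraph \<Rightarrow> ('a \<Rightarrow> nat) \<Rightarrow> bool" for k where
  single_vertex:
    "i < k \<Longrightarrow> cw_constructs k \<lparr> pverts = {v}, parcs = {} \<rparr> (\<lambda>_. i)"
| label_union:
    "\<lbrakk> cw_constructs k G l; cw_constructs k G' l'; pverts G \<inter> pverts G' = {} \<rbrakk> \<Longrightarrow>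
     cw_constructs k \<lparr> pverts = pverts G \<union> pverts G', parcs = parcs G \<union> parcs G' \<rparr>
       (\<lambda>v. if v \<in> pverts G then l v else l' v)"
| label_join:
    "\<lbrakk> cw_constructs k G l; i < k; j < k; i \<noteq> j \<rbrakk> \<Longrightarrow>
     cw_constructs k \<lparr> pverts = pverts G,
       parcs = parcs G \<union> {(u, v). u \<in> pverts G \<and> v \<in> pverts G \<and>
         (l u = i \<and> l v = j \<or> l u = j \<and> l v = i)} \<rparr> l"
| relabel:
    "\<lbrakk> cw_constructs k G l; i < k; j < k \<rbrakk> \<Longrightarrow>
     cw_constructs k G (\<lambda>v. if l v = i then j else l v)"

text \<open>
  The operations never produce the graph without vertices; its clique-width is set to 0. For every
  other finite simple graph the minimum is attained, see \<open>cw_constructs_exists\<close> below.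
\<close>
definition clique_width :: "'a pair_pre_digraph \<Rightarrow> nat" where
  "clique_width G =
     (if pverts G = {} then 0 else LEAST k. \<exists>l. cw_constructs k G l)"

text \<open>
  The constant is chosen per vertex type. For vertex type \<^typ>\<open>nat\<close> the class contains every
  finite graph up to isomorphism, so that instance already provides one constant for all graphs.
\<close>
definition bounded_clique_width :: "'a pair_pre_digraph set \<Rightarrow> bool" where
  "bounded_clique_width \<G> \<longleftrightarrow> (\<exists>c. \<forall>G\<in>\<G>. clique_width G \<le> c)"

lemma pair_graph_iff:
  "pair_graph G \<longleftrightarrow> finite (pverts G) \<and> parcs G \<subseteq> pverts G \<times> pverts G \<and> sym (parcs G) \<and>
     irrefl (parcs G)" (is "?L \<longleftrightarrow> ?R")
proof
  assume ?L
  then interpret pair_graph G .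
  show ?R
    using pair_finite_verts in_arcsD1 in_arcsD2 pair_sym_arcs pair_no_loops
    by (fastforce simp: symmetric_def irrefl_def)
next
  assume R: ?R
  then have "finite (parcs G)"
    by (meson finite_SigmaI finite_subset)
  with R show ?L
    by unfold_locales (auto simp: symmetric_def irrefl_def)
qed

lemma pair_graph_path_graph: "pair_graph (path_graph r)"
  by (auto simp: pair_graph_iff path_graph_def sym_def irrefl_def)

lemma pair_graph_cycle_graph:
  assumes "r \<ge> 3"
  shows "pair_graph (cycle_graph r)"
proof -
  have "i \<noteq> Suc i mod r" if "i < r" for i
    using that assms by (cases "Suc i = r") auto
  then show ?thesis
    by (auto simp: pair_graph_iff cycle_graph_def sym_def irrefl_def)
qed

lemma pair_graph_complement_graph: "pair_graph G \<Longrightarrow> pair_graph (complement_graph G)"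
  by (auto simp: pair_graph_iff complement_graph_def sym_def irrefl_def)

lemma pair_graph_disjoint_union: "pair_graph G \<Longrightarrow> pair_graph H \<Longrightarrow> pair_graph (G +\<^sub>G H)"
  by (fastforce simp: pair_graph_iff disjoint_union_def sym_def irrefl_def)

lemma cw_constructs_pair_graph: "cw_constructs k G l \<Longrightarrow> pair_graph G \<and> pverts G \<noteq> {}"
  by (induction rule: cw_constructs.induct) (auto simp: pair_graph_iff sym_def irrefl_def)

lemma cw_constructs_label_less: "cw_constructs k G l \<Longrightarrow> v \<in> pverts G \<Longrightarrow> l v < k"
  by (induction rule: cw_constructs.induct) auto

lemma H_free_iff_embedding:
  assumes G: "pair_graph G" and H: "pair_graph H"
  shows "H_free H G \<longleftrightarrow>
    \<not> (\<exists>f. inj_on f (pverts H) \<and> f ` pverts H \<subseteq> pverts G \<and>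
         (\<forall>u\<in>pverts H. \<forall>v\<in>pverts H. (f u, f v) \<in> parcs G \<longleftrightarrow> (u, v) \<in> parcs H))"
    (is "_ \<longleftrightarrow> \<not> ?E")
proof -
  have "?E" if K: "induced_subgraph K (with_proj G)" "digraph_iso K (with_proj H)" for K
  proof -
    from K obtain h where h: "pre_digraph.digraph_isomorphism K h" "with_proj H = app_iso h K"
      by (auto simp: digraph_iso_def)
    let ?g = "iso_verts h"
    have tl: "tail K = fst" "head K = snd"
      using K(1) by (auto simp: induced_subgraph_def subgraph_def compatible_def)
    have vK: "verts K \<subseteq> pverts G"
      and aK: "arcs K = {e \<in> parcs G. fst e \<in> verts K \<and> snd e \<in> verts K}"
      using K(1) tl by (auto simp: induced_subgraph_def subgraph_def)
    have inj: "inj_on ?g (verts K)"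
      and ia: "\<And>a. a \<in> arcs K \<Longrightarrow> ?g (fst a) = iso_tail h (iso_arcs h a) \<and>
                 ?g (snd a) = iso_head h (iso_arcs h a)"
      using h(1) tl by (auto simp: pre_digraph.digraph_isomorphism_def)
    have e: "pverts H = ?g ` verts K" "parcs H = iso_arcs h ` arcs K"
      "iso_tail h = fst" "iso_head h = snd"
      using arg_cong[OF h(2), of verts] arg_cong[OF h(2), of arcs]
        arg_cong[OF h(2), of tail] arg_cong[OF h(2), of head]
      by (auto simp: app_iso_def)
    have "iso_arcs h a = (?g (fst a), ?g (snd a))" if "a \<in> arcs K" for a
      using ia[OF that] e by (metis prod.collapse)
    then have pH: "parcs H = (\<lambda>a. (?g (fst a), ?g (snd a))) ` arcs K"
      using e(2) by auto
    have adj: "(u, v) \<in> parcs G \<longleftrightarrow> (?g u, ?g v) \<in> parcs H"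
      if "u \<in> verts K" "v \<in> verts K" for u v
    proof
      assume "(u, v) \<in> parcs G"
      then have "(u, v) \<in> arcs K"
        using aK that by auto
      then show "(?g u, ?g v) \<in> parcs H"
        using pH by force
    next
      assume "(?g u, ?g v) \<in> parcs H"
      then obtain a where "a \<in> arcs K" "?g u = ?g (fst a)" "?g v = ?g (snd a)"
        using pH by auto
      moreover from this have "u = fst a" "v = snd a"
        using aK that inj by (auto dest: inj_onD)
      ultimately show "(u, v) \<in> parcs G"
        using aK by simp
    qed
    let ?f = "the_inv_into (verts K) ?g"
    have fg: "?f (?g u) = u" if "u \<in> verts K" for u
      using that inj by (simp add: the_inv_into_f_f)
    have "inj_on ?f (pverts H)"
      using inj e(1) by (simp add: inj_on_the_inv_into)
    moreover have "?f ` pverts H \<subseteq> pverts G"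
      using vK fg e(1) by auto
    moreover have "\<forall>u\<in>pverts H. \<forall>v\<in>pverts H. (?f u, ?f v) \<in> parcs G \<longleftrightarrow> (u, v) \<in> parcs H"
      using adj fg e(1) by auto
    ultimately show ?E by blast
  qed
  moreover have "\<exists>K. induced_subgraph K (with_proj G) \<and> digraph_iso K (with_proj H)" if E: ?E
  proof -
    interpret G: pair_graph G by fact
    interpret H: pair_graph H by fact
    from E obtain f where inj: "inj_on f (pverts H)" and sub: "f ` pverts H \<subseteq> pverts G"
      and adj: "\<And>u v. u \<in> pverts H \<Longrightarrow> v \<in> pverts H \<Longrightarrow>
                  (f u, f v) \<in> parcs G \<longleftrightarrow> (u, v) \<in> parcs H"
      by blast
    let ?W = "f ` pverts H"
    let ?K = "with_proj G \<restriction> ?W"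
    let ?g = "the_inv_into (pverts H) f"
    have gf: "?g (f u) = u" if "u \<in> pverts H" for u
      using that inj by (simp add: the_inv_into_f_f)
    have ind: "induced_subgraph ?K (with_proj G)"
      using sub by (simp add: G.induced_induce)
    let ?h = "\<lparr> iso_verts = ?g, iso_arcs = map_prod ?g ?g, iso_head = snd, iso_tail = fst \<rparr>"
    have wf: "wf_digraph ?K"
      using ind by (auto simp: induced_subgraph_def subgraph_def)
    have injg: "inj_on ?g ?W"
      using inj by (simp add: inj_on_the_inv_into)
    have aK: "arcs ?K = parcs G \<inter> ?W \<times> ?W"
      by (auto simp: induce_subgraph_def)
    have inja: "inj_on (map_prod ?g ?g) (arcs ?K)"
      using inj_on_subset[OF map_prod_inj_on[OF injg injg]] aK by blast
    have iso: "pre_digraph.digraph_isomorphism ?K ?h"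
      using wf injg inja by (auto simp: pre_digraph.digraph_isomorphism_def)
    have v: "?g ` ?W = pverts H"
      using gf by force
    have "map_prod ?g ?g ` arcs ?K = parcs H"
    proof (intro equalityI subsetI)
      fix a assume "a \<in> map_prod ?g ?g ` arcs ?K"
      then show "a \<in> parcs H"
        using aK adj gf by auto
    next
      fix a assume a: "a \<in> parcs H"
      obtain u w where uw: "a = (u, w)" by (cases a)
      have uwH: "u \<in> pverts H" "w \<in> pverts H"
        using a uw H.in_arcsD1 H.in_arcsD2 by auto
      then have "(f u, f w) \<in> arcs ?K"
        using a uw adj aK by auto
      then have "map_prod ?g ?g (f u, f w) \<in> map_prod ?g ?g ` arcs ?K"
        by (rule imageI)
      then show "a \<in> map_prod ?g ?g ` arcs ?K"
        using gf uwH uw by simp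
    qed
    then have "with_proj H = app_iso ?h ?K"
      using v by (simp add: app_iso_def with_proj_def)
    then show ?thesis
      using ind iso by (auto simp: digraph_iso_def)
  qed
  ultimately show ?thesis
    unfolding H_free_def by blast
qed

lemma cw_constructs_mono: "cw_constructs k G l \<Longrightarrow> k \<le> k' \<Longrightarrow> cw_constructs k' G l"
  by (induction rule: cw_constructs.induct)
    (auto intro: cw_constructs.intros)

lemma cw_constructs_add_star:
  assumes "cw_constructs k \<lparr> pverts = W, parcs = E \<rparr> l" "inj_on l W" "x \<in> W"
    and "finite N" "N \<subseteq> W - {x}"
  shows "cw_constructs k \<lparr> pverts = W, parcs = E \<union> {x} \<times> N \<union> N \<times> {x} \<rparr> l"
  using assms(4,5)
proof (induction N rule: finite_induct)
  case empty
  then show ?case using assms(1) by simp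
next
  case (insert y N)
  then have G: "cw_constructs k \<lparr> pverts = W, parcs = E \<union> {x} \<times> N \<union> N \<times> {x} \<rparr> l"
    by simp
  have y: "y \<in> W" "x \<noteq> y"
    using insert.prems by auto
  have lt: "l x < k" "l y < k"
    using cw_constructs_label_less[OF assms(1)] assms(3) y by auto
  have ne: "l x \<noteq> l y"
    using assms(2,3) y by (auto dest: inj_onD)
  have "{(u, v). u \<in> W \<and> v \<in> W \<and> (l u = l x \<and> l v = l y \<or> l u = l y \<and> l v = l x)}
      = {(x, y), (y, x)}"
    using assms(2,3) y by (auto dest: inj_onD)
  moreover have "E \<union> {x} \<times> N \<union> N \<times> {x} \<union> {(x, y), (y, x)}
      = E \<union> {x} \<times> insert y N \<union> insert y N \<times> {x}"
    by auto
  ultimately show ?case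
    using label_join[OF G lt ne] by simp
qed

lemma cw_constructs_exists_aux:
  assumes "finite V" "V \<noteq> {}" "E \<subseteq> V \<times> V" "sym E" "irrefl E"
  shows "\<exists>l. cw_constructs (card V) \<lparr> pverts = V, parcs = E \<rparr> l \<and> inj_on l V"
  using assms
proof (induction V arbitrary: E rule: finite_ne_induct)
  case (singleton x)
  then have "E = {}"
    by (auto simp: irrefl_def)
  then show ?case
    using single_vertex[of 0 1 x] by auto
next
  case (insert x V)
  let ?E = "E \<inter> V \<times> V"
  have "sym ?E" "irrefl ?E"
    using insert.prems by (auto simp: sym_def irrefl_def)
  with insert.IH[of ?E] obtain l
    where l: "cw_constructs (card V) \<lparr> pverts = V, parcs = ?E \<rparr> l" "inj_on l V"
    by auto
  let ?k = "card (insert x V)"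
  let ?l = "\<lambda>v. if v \<in> V then l v else card V"
  have k: "?k = Suc (card V)"
    using insert by simp
  have "cw_constructs ?k \<lparr> pverts = V \<union> {x}, parcs = ?E \<union> {} \<rparr> ?l"
    using label_union[OF cw_constructs_mono[OF l(1), of ?k] single_vertex[of "card V" ?k x]]
      k insert.hyps by simp
  moreover have "inj_on ?l (V \<union> {x})"
  proof -
    have "inj_on ?l V"
      using l(2) by (simp add: inj_on_def)
    moreover have "l v \<noteq> card V" if "v \<in> V" for v
      using cw_constructs_label_less[OF l(1), of v] that by simp
    ultimately have "card V \<notin> ?l ` V" "inj_on ?l V"
      by (auto simp: image_iff) metis
    then show ?thesis
      using insert.hyps by simp
  qed
  moreover have "{v. (x, v) \<in> E} \<subseteq> V \<union> {x} - {x}"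
    using insert.prems by (auto simp: irrefl_def)
  moreover from this have "finite {v. (x, v) \<in> E}"
    using insert.hyps finite_subset by fastforce
  ultimately have "cw_constructs ?k \<lparr> pverts = V \<union> {x},
      parcs = ?E \<union> {} \<union> {x} \<times> {v. (x, v) \<in> E} \<union> {v. (x, v) \<in> E} \<times> {x} \<rparr> ?l"
    by (intro cw_constructs_add_star) auto
  moreover have "?E \<union> {} \<union> {x} \<times> {v. (x, v) \<in> E} \<union> {v. (x, v) \<in> E} \<times> {x} = E"
    using insert.prems by (auto simp: sym_def)
  moreover note \<open>inj_on ?l (V \<union> {x})\<close>
  ultimately show ?case
    by (metis Un_insert_right sup_bot_right)
qed

lemma cw_constructs_exists:
  assumes "pair_graph G" "pverts G \<noteq> {}"
  shows "\<exists>l. cw_constructs (card (pverts G)) G l"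
  using cw_constructs_exists_aux[of "pverts G" "parcs G"] assms
  by (cases G) (auto simp: pair_graph_iff)

lemma clique_width_attained:
  assumes "pair_graph G" "pverts G \<noteq> {}"
  shows "\<exists>l. cw_constructs (clique_width G) G l"
  using LeastI_ex[of "\<lambda>k. \<exists>l. cw_constructs k G l"] cw_constructs_exists[OF assms] assms(2)
  unfolding clique_width_def by auto

end

theory Submission
  imports Defs
begin

text \<open>
  Bounded clique-width is shown through layouts: recursive bipartitions of the vertex set such that
  each part has boundedly many different neighbourhoods outside itself. This width is insensitive
  (up to constants) to deleting boundedly many vertices and to flipping adjacency between boundedly
  many classes of vertices, and diamond-free chordal graphs and bipartite chain graphs have width 2
  because pendant vertices and twins can be pruned from them.

  In a \<open>(P\<^sub>1 + diamond)\<close>-free graph every diamond is dominating. Take nonadjacent \<open>c\<close>, \<open>d\<close>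
  with as many common neighbours as possible. Their common neighbourhood \<open>M\<close> is a clique that
  separates \<open>c\<close> from \<open>d\<close>, so no diamond avoids \<open>M\<close>. If some \<open>r\<close> outside \<open>M\<close> is adjacent neither
  to \<open>c\<close> nor to \<open>d\<close>, then after deleting two vertices every vertex outside \<open>M\<close> misses at most one
  vertex of \<open>M\<close>. Otherwise the rest of \<open>G\<close> consists of \<open>P = N(c) - M\<close> and \<open>Q = N(d) - M\<close>, two
  mutually nonadjacent disjoint unions of cliques, each of whose cliques has nested neighbourhoods
  in \<open>M\<close>, and nonadjacent vertices of \<open>P\<close> have nearly the same neighbours in \<open>M\<close>. In both cases
  deletions and flips leave graphs in which each component is a chain graph or becomes
  diamond-free chordal after removing a single vertex of \<open>M\<close>.
\<close>

section \<open>Layouts\<close>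

text \<open>
  The empty neighbourhood is always counted. Hence cardinality at most 2 says that all nonempty
  outer neighbourhoods coincide, a condition that survives adding pendant vertices.
\<close>
definition outer_nbhds :: "('a \<Rightarrow> 'a \<Rightarrow> bool) \<Rightarrow> 'a set \<Rightarrow> 'a set \<Rightarrow> 'a set set" where
  "outer_nbhds E V X = insert {} ((\<lambda>x. {y \<in> V - X. E x y}) ` X)"

text \<open>The ambient \<open>V\<close> stays fixed during the recursion, so layouts of disjoint
  parts of \<open>V\<close> can be glued. Apart from the empty set that is always counted, the width
  is the one known as module-width.\<close>

inductive layout :: "nat \<Rightarrow> ('a \<Rightarrow> 'a \<Rightarrow> bool) \<Rightarrow> 'a set \<Rightarrow> 'a set \<Rightarrow> bool" for k E V where
  layout_single: "\<lbrakk> v \<in> V; card (outer_nbhds E V {v}) \<le> k \<rbrakk> \<Longrightarrow> layout k E V {v}"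
| layout_join: "\<lbrakk> layout k E V A; layout k E V B; A \<inter> B = {};
     card (outer_nbhds E V (A \<union> B)) \<le> k \<rbrakk> \<Longrightarrow> layout k E V (A \<union> B)"

definition layout_width_le :: "nat \<Rightarrow> 'a set \<Rightarrow> ('a \<Rightarrow> 'a \<Rightarrow> bool) \<Rightarrow> bool" where
  "layout_width_le k V E \<longleftrightarrow> V = {} \<or> layout k E V V"

lemma finite_outer_nbhds: "finite X \<Longrightarrow> finite (outer_nbhds E V X)"
  by (simp add: outer_nbhds_def)

lemma outer_nbhds_subset:
  "{} \<in> T \<Longrightarrow> (\<And>x. x \<in> X \<Longrightarrow> {y \<in> V - X. E x y} \<in> T) \<Longrightarrow> outer_nbhds E V X \<subseteq> T"
  by (auto simp: outer_nbhds_def)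

lemma empty_in_outer_nbhds: "{} \<in> outer_nbhds E V X"
  by (simp add: outer_nbhds_def)

lemma nbhd_in_outer_nbhds: "x \<in> X \<Longrightarrow> {y \<in> V - X. E x y} \<in> outer_nbhds E V X"
  by (simp add: outer_nbhds_def)

text \<open>Neighbourhoods are counted through codes: \<open>h\<close> encodes a vertex by an
  element of \<open>T\<close>, and \<open>g\<close> decodes it. The element \<open>t\<close>
  accounts for the empty set that \<open>outer_nbhds\<close> always contains.\<close>

lemma card_outer_nbhds_image:
  assumes "finite T" "t \<in> T" "g t = {}"
    and "\<And>x. x \<in> X \<Longrightarrow> h x \<in> T" "\<And>x. x \<in> X \<Longrightarrow> {y \<in> V - X. E x y} = g (h x)"
  shows "card (outer_nbhds E V X) \<le> card T"
proof (rule surj_card_le[OF assms(1)])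
  show "outer_nbhds E V X \<subseteq> g ` T"
    using assms by (intro outer_nbhds_subset) (metis imageI)+
qed

lemma outer_nbhds_self [simp]: "outer_nbhds E V V = {{}}"
  by (auto simp: outer_nbhds_def)

lemma layout_subset: "layout k E V X \<Longrightarrow> finite X \<and> X \<subseteq> V \<and> X \<noteq> {}"
  by (induction rule: layout.induct) auto

text \<open>The same binary tree serves for another adjacency or a larger ambient set; only the
  bound at each node has to be rechecked.\<close>

lemma layout_transfer:
  assumes "layout k E V X"
    and "\<And>X. X \<subseteq> V \<Longrightarrow> finite X \<Longrightarrow> card (outer_nbhds E V X) \<le> k \<Longrightarrow> card (outer_nbhds E' V' X) \<le> k'"
    and "V \<subseteq> V'"
  shows "layout k' E' V' X"
  using assms(1)
proof (induction rule: layout.induct)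
  case (layout_single v)
  then show ?case
    using assms(2)[of "{v}"] assms(3) by (auto intro: layout.layout_single)
next
  case (layout_join A B)
  then show ?case
    using assms(2)[of "A \<union> B"] layout_subset[OF layout_join.hyps(1)] layout_subset[OF layout_join.hyps(2)]
    by (intro layout.layout_join) auto
qed

section \<open>Operations that change the width by a bounded amount\<close>

lemma layout_width_le_mono: "layout_width_le k V E \<Longrightarrow> k \<le> k' \<Longrightarrow> layout_width_le k' V E"
  unfolding layout_width_le_def using layout_transfer[of k E V V E V k'] by auto

lemma layout_width_le_cong:
  assumes "layout_width_le k V E" "\<And>x y. x \<in> V \<Longrightarrow> y \<in> V \<Longrightarrow> x \<noteq> y \<Longrightarrow> E' x y = E x y"
  shows "layout_width_le k V E'"
proof -
  have "outer_nbhds E' V X = outer_nbhds E V X" if "X \<subseteq> V" for X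
  proof -
    have "{y \<in> V - X. E' x y} = {y \<in> V - X. E x y}" if "x \<in> X" for x
      using assms(2) that \<open>X \<subseteq> V\<close> by blast
    then show ?thesis
      unfolding outer_nbhds_def by (metis (no_types, lifting) image_cong)
  qed
  then show ?thesis
    using assms(1) layout_transfer[of k E V V E' V k] unfolding layout_width_le_def by auto
qed

text \<open>Each neighbourhood inside \<open>V - {v}\<close> splits into at most two, according to
  adjacency to \<open>v\<close>; the Boolean in the code records which.\<close>

lemma layout_insert_vertex:
  assumes "layout k E (V - {v}) X" "v \<in> V"
  shows "layout (2 * k) E V X"
  using assms(1)
proof (rule layout_transfer)
  fix X assume X: "X \<subseteq> V - {v}" "finite X" "card (outer_nbhds E (V - {v}) X) \<le> k"
  let ?g = "\<lambda>(S, b). if b then insert v S else S"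
  have "card (outer_nbhds E V X) \<le> card (outer_nbhds E (V - {v}) X \<times> (UNIV :: bool set))"
  proof (rule card_outer_nbhds_image[where g = ?g and t = "({}, False)"
        and h = "\<lambda>x. ({y \<in> V - {v} - X. E x y}, E x v)"])
    show "{y \<in> V - X. E x y} = ?g ({y \<in> V - {v} - X. E x y}, E x v)" if "x \<in> X" for x
      using that X(1) assms(2) by auto
  qed (simp_all only: finite_cartesian_product finite_outer_nbhds[OF X(2)] finite_class.finite_UNIV
      mem_Times_iff fst_conv snd_conv UNIV_I empty_in_outer_nbhds nbhd_in_outer_nbhds prod.case if_False simp_thms)
  also have "\<dots> \<le> 2 * k"
    using X(3) by (simp add: card_cartesian_product)
  finally show "card (outer_nbhds E V X) \<le> 2 * k" .
qed auto

text \<open>The vertex \<open>v\<close> becomes the sibling of the whole layout of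
  \<open>V - {v}\<close> at the root.\<close>

lemma layout_width_le_delete1:
  assumes "layout_width_le k (V - {v}) E" "k > 0"
  shows "layout_width_le (2 * k) V E"
proof (cases "v \<in> V")
  case True
  have single: "layout (2 * k) E V {v}"
  proof (rule layout_single)
    have "card (outer_nbhds E V {v}) \<le> 2"
      unfolding outer_nbhds_def by (simp add: card_insert_if)
    then show "card (outer_nbhds E V {v}) \<le> 2 * k"
      using assms(2) by simp
  qed (use True in simp)
  show ?thesis
  proof (cases "V = {v}")
    case True
    with single show ?thesis by (simp add: layout_width_le_def)
  next
    case False
    then have "layout k E (V - {v}) (V - {v})"
      using assms(1) True by (auto simp: layout_width_le_def)
    then have "layout (2 * k) E V ((V - {v}) \<union> {v})"
      by (intro layout_join layout_insert_vertex single) (use True assms(2) in \<open>auto simp: insert_absorb\<close>)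
    then show ?thesis
      using True by (simp add: layout_width_le_def insert_absorb)
  qed
next
  case False
  then show ?thesis
    using assms layout_width_le_mono[of k V E "2 * k"] by simp
qed

lemma layout_width_le_delete:
  assumes "layout_width_le k (V - Z) E" "finite Z" "card Z \<le> z" "k > 0"
  shows "layout_width_le (k * 2 ^ z) V E"
proof -
  have "layout_width_le (k * 2 ^ card Z) V E"
    using assms(2,1)
  proof (induction Z arbitrary: V rule: finite_induct)
    case (insert x Z)
    then have "layout_width_le (k * 2 ^ card Z) (V - {x}) E"
      by (metis Diff_insert2)
    then show ?case
      using layout_width_le_delete1[of "k * 2 ^ card Z" V x E] insert assms(4)
      by (simp add: algebra_simps)
  qed simp
  then show ?thesis
    by (rule layout_width_le_mono) (use assms(3) in simp)
qed

text \<open>The class of \<open>x\<close> together with its neighbourhood under \<open>E'\<close>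
  determines its neighbourhood under \<open>E\<close>, which leaves at most \<open>m * k\<close>
  codes. The extra code \<open>None\<close> stands for the empty set and causes the
  \<open>+ 1\<close>.\<close>

lemma layout_width_le_flip:
  assumes "layout_width_le k V E'" "card (f ` V) \<le> m" "finite V"
    and flip: "\<And>x y. x \<in> V \<Longrightarrow> y \<in> V \<Longrightarrow> x \<noteq> y \<Longrightarrow> E' x y = (E x y \<noteq> D (f x) (f y))"
  shows "layout_width_le (m * k + 1) V E"
proof -
  have "layout (m * k + 1) E V V" if "layout k E' V V"
    using that
  proof (rule layout_transfer)
    fix X assume X: "X \<subseteq> V" "finite X" "card (outer_nbhds E' V X) \<le> k"
    let ?g = "\<lambda>(c, S). {y \<in> V - X. (y \<in> S) \<noteq> D c (f y)}"
    let ?T = "f ` V \<times> outer_nbhds E' V X"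
    have fin: "finite ?T"
      using X(2) assms(3) by (simp add: finite_outer_nbhds)
    have "card (outer_nbhds E V X) \<le> card (insert None (Some ` ?T))"
    proof (rule card_outer_nbhds_image[where g = "\<lambda>t. case t of None \<Rightarrow> {} | Some p \<Rightarrow> ?g p" and t = None
          and h = "\<lambda>x. Some (f x, {y \<in> V - X. E' x y})"])
      show "{y \<in> V - X. E x y} = (case Some (f x, {y \<in> V - X. E' x y}) of None \<Rightarrow> {} | Some p \<Rightarrow> ?g p)"
        if "x \<in> X" for x
      proof -
        have "E' x y = (E x y \<noteq> D (f x) (f y))" if "y \<in> V - X" for y
          using \<open>x \<in> X\<close> that X(1) by (intro flip) auto
        then show ?thesis by auto
      qed
      show "Some (f x, {y \<in> V - X. E' x y}) \<in> insert None (Some ` ?T)" if "x \<in> X" for x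
        by (intro insertI2 imageI SigmaI nbhd_in_outer_nbhds that) (use that X(1) in blast)
    qed (use fin in auto)
    also have "\<dots> \<le> Suc (card ?T)"
      using fin card_image_le[OF fin, of Some] by (simp add: card_insert_if)
    also have "\<dots> \<le> m * k + 1"
      using assms(2) X(3) by (simp add: card_cartesian_product mult_le_mono)
    finally show "card (outer_nbhds E V X) \<le> m * k + 1" .
  qed simp
  then show ?thesis
    using assms(1) by (auto simp: layout_width_le_def)
qed

lemma layout_extend_separated:
  assumes "layout k E A X" "A \<subseteq> V" "\<And>x y. x \<in> A \<Longrightarrow> y \<in> V - A \<Longrightarrow> \<not> E x y"
  shows "layout k E V X"
  using assms(1)
proof (rule layout_transfer)
  fix X assume X: "X \<subseteq> A" "card (outer_nbhds E A X) \<le> k"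
  have "{y \<in> V - X. E x y} = {y \<in> A - X. E x y}" if "x \<in> X" for x
    using that X(1) assms(2,3) by blast
  then have "outer_nbhds E V X = outer_nbhds E A X"
    unfolding outer_nbhds_def by (auto simp: image_iff)
  with X show "card (outer_nbhds E V X) \<le> k" by simp
qed (use assms in auto)

lemma layout_width_le_union:
  assumes "layout_width_le k A E" "layout_width_le k B E" "A \<inter> B = {}" "k > 0"
    and "\<And>x y. x \<in> A \<Longrightarrow> y \<in> B \<Longrightarrow> \<not> E x y" "\<And>x y. x \<in> A \<Longrightarrow> y \<in> B \<Longrightarrow> \<not> E y x"
  shows "layout_width_le k (A \<union> B) E"
proof (cases "A = {} \<or> B = {}")
  case False
  then have "layout k E A A" "layout k E B B"
    using assms(1,2) by (auto simp: layout_width_le_def)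
  moreover have "\<not> E x y" if "x \<in> A" "y \<in> A \<union> B - A" for x y
    using assms(5)[of x y] that by blast
  moreover have "\<not> E x y" if "x \<in> B" "y \<in> A \<union> B - B" for x y
    using assms(6)[of y x] that by blast
  ultimately have "layout k E (A \<union> B) A" "layout k E (A \<union> B) B"
    by (blast intro: layout_extend_separated)+
  moreover have "card (outer_nbhds E (A \<union> B) (A \<union> B)) \<le> k"
    using assms(4) by simp
  ultimately show ?thesis
    unfolding layout_width_le_def using layout_join[OF _ _ assms(3)] by blast
next
  case True
  then show ?thesis
    using assms(1,2) by (elim disjE) simp_all
qed

text \<open>A map constant along edges makes every fibre a union of components, so components are
  treated without being named. The fibres are laid out separately and added one by one.\<close>

lemma layout_width_le_fibres:
  assumes "finite V" "k > 0" "\<And>x y. x \<in> V \<Longrightarrow> y \<in> V \<Longrightarrow> E x y \<Longrightarrow> \<phi> x = \<phi> y"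
    and "\<And>i. layout_width_le k {x \<in> V. \<phi> x = i} E"
  shows "layout_width_le k V E"
proof -
  have "layout_width_le k {x \<in> V. \<phi> x \<in> I} E" if "finite I" for I
    using that
  proof (induction I rule: finite_induct)
    case empty
    then show ?case by (simp add: layout_width_le_def)
  next
    case (insert i I)
    have "layout_width_le k ({x \<in> V. \<phi> x = i} \<union> {x \<in> V. \<phi> x \<in> I}) E"
    proof (rule layout_width_le_union)
      show "\<not> E x y" if "x \<in> {x \<in> V. \<phi> x = i}" "y \<in> {x \<in> V. \<phi> x \<in> I}" for x y
        using that assms(3)[of x y] insert.hyps by auto
      show "\<not> E y x" if "x \<in> {x \<in> V. \<phi> x = i}" "y \<in> {x \<in> V. \<phi> x \<in> I}" for x y
        using that assms(3)[of y x] insert.hyps by auto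
    qed (use assms(2,4) insert in auto)
    moreover have "{x \<in> V. \<phi> x = i} \<union> {x \<in> V. \<phi> x \<in> I} = {x \<in> V. \<phi> x \<in> insert i I}"
      by auto
    ultimately show ?case by simp
  qed
  moreover have "{x \<in> V. \<phi> x \<in> \<phi> ` V} = V"
    by auto
  ultimately show ?thesis
    using assms(1) by (metis finite_imageI)
qed

text \<open>Erasing the edges between \<open>A\<close> and \<open>B\<close> is a flip whose classes
  record the side of a vertex besides its colour; what remains is a disjoint union.\<close>

lemma layout_width_le_join:
  fixes f :: "'a \<Rightarrow> 'c::finite"
  assumes "layout_width_le k A E" "layout_width_le k B E" "A \<inter> B = {}" "k > 0"
    and "finite A" "finite B"
    and "\<And>x y. x \<in> A \<Longrightarrow> y \<in> B \<Longrightarrow> E x y = D (f x) (f y)"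
    and "\<And>x y. E x y \<Longrightarrow> E y x"
  shows "layout_width_le (2 * card (UNIV :: 'c set) * k + 1) (A \<union> B) E"
proof (rule layout_width_le_flip)
  let ?E' = "\<lambda>x y. E x y \<and> (x \<in> A \<longleftrightarrow> y \<in> A)"
  let ?f = "\<lambda>x. (x \<in> A, f x)"
  \<comment> \<open>\<open>D\<close> need not be symmetric; the first components tell which endpoint
    lies in \<open>A\<close> and is to be its first argument.\<close>
  let ?D = "\<lambda>(a, c) (b, d). if a \<and> \<not> b then D c d else if \<not> a \<and> b then D d c else False"
  show "layout_width_le k (A \<union> B) ?E'"
  proof (rule layout_width_le_union)
    show "layout_width_le k A ?E'"
      by (rule layout_width_le_cong[OF assms(1)]) simp
    show "layout_width_le k B ?E'"
      by (rule layout_width_le_cong[OF assms(2)]) (use assms(3) in auto)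
  qed (use assms(3,4) in auto)
  have "card (?f ` (A \<union> B)) \<le> card (UNIV :: (bool \<times> 'c) set)"
    by (intro card_mono) auto
  then show "card (?f ` (A \<union> B)) \<le> 2 * card (UNIV :: 'c set)"
    by (simp add: card_cartesian_product flip: UNIV_Times_UNIV)
  show "?E' x y = (E x y \<noteq> ?D (?f x) (?f y))"
    if "x \<in> A \<union> B" "y \<in> A \<union> B" for x y
    using that assms(3) assms(7)[of x y] assms(7)[of y x] assms(8)[of x y] assms(8)[of y x] by auto
qed (use assms(5,6) in auto)

text \<open>The case \<open>N(x) \<subseteq> {v}\<close> covers isolated as well as pendant \<open>x\<close>; twins may be true or false.\<close>
definition prunable :: "'a set \<Rightarrow> ('a \<Rightarrow> 'a \<Rightarrow> bool) \<Rightarrow> 'a \<Rightarrow> 'a \<Rightarrow> bool" where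
  "prunable V E x v \<longleftrightarrow> x \<in> V \<and> v \<in> V \<and> x \<noteq> v \<and>
     ((\<forall>y\<in>V. E x y \<longrightarrow> y = v) \<or> (\<forall>y\<in>V - {x, v}. E x y = E v y))"

text \<open>The vertex \<open>x\<close> is hung beside the leaf \<open>v\<close>, so exactly the
  sets containing \<open>v\<close> gain \<open>x\<close>. There \<open>x\<close> contributes no
  neighbourhood besides the empty one and that of \<open>v\<close>; \<open>k \<ge> 2\<close> covers
  the leaves.\<close>

lemma layout_prunable:
  assumes "prunable V E x v" and sym: "\<And>x y. E x y \<Longrightarrow> E y x" and "k \<ge> 2"
    and "layout k E (V - {x}) X"
  shows "layout k E V (if v \<in> X then insert x X else X)"
proof -
  have xv: "x \<in> V" "v \<in> V" "x \<noteq> v"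
    using assms(1) by (auto simp: prunable_def)
  have with_v: "card (outer_nbhds E V (insert x X)) \<le> k"
    if "X \<subseteq> V - {x}" "v \<in> X" "card (outer_nbhds E (V - {x}) X) \<le> k" for X
  proof -
    have "{y \<in> V - insert x X. E x y} = {} \<or> {y \<in> V - insert x X. E x y} = {y \<in> V - insert x X. E v y}"
      using assms(1) that(2) unfolding prunable_def by blast
    moreover have "V - insert x X = V - {x} - X"
      by auto
    ultimately have "outer_nbhds E V (insert x X) = outer_nbhds E (V - {x}) X"
      using that unfolding outer_nbhds_def by auto
    with that show ?thesis by simp
  qed
  have without_v: "card (outer_nbhds E V X) \<le> k"
    if X: "X \<subseteq> V - {x}" "v \<notin> X" "card (outer_nbhds E (V - {x}) X) \<le> k" "finite X" for X
  proof -
    consider "\<forall>y\<in>V. E x y \<longrightarrow> y = v" | "\<forall>y\<in>V - {x, v}. E x y = E v y"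
      using assms(1) by (auto simp: prunable_def)
    then show ?thesis
    proof cases
      case 1
      then have "{z \<in> V - X. E y z} = {z \<in> V - {x} - X. E y z}" if "y \<in> X" for y
        using X(1,2) that sym by blast
      then have "outer_nbhds E V X = outer_nbhds E (V - {x}) X"
        unfolding outer_nbhds_def by auto
      with X show ?thesis by simp
    next
      case 2
      \<comment> \<open>A vertex of \<open>X\<close> sees the twin \<open>x\<close> exactly when it
        sees \<open>v\<close>, so \<open>x\<close> is restored to the neighbourhoods that contain
        \<open>v\<close>.\<close>
      let ?g = "\<lambda>S. if v \<in> S then insert x S else S"
      have "E y x = E y v" if "y \<in> X" for y
        using 2 X(1,2) that sym by blast
      then have g: "{z \<in> V - X. E y z} = ?g {z \<in> V - {x} - X. E y z}" if "y \<in> X" for y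
        using X(1,2) that xv by auto
      have "card (outer_nbhds E V X) \<le> card (outer_nbhds E (V - {x}) X)"
        by (rule card_outer_nbhds_image[where g = ?g and t = "{}", OF _ _ _ nbhd_in_outer_nbhds g])
          (simp_all add: X(4) finite_outer_nbhds empty_in_outer_nbhds)
      with X show ?thesis by simp
    qed
  qed
  from assms(4) show ?thesis
  proof (induction rule: layout.induct)
    case (layout_single w)
    have single: "card (outer_nbhds E V {u}) \<le> k" for u
      using assms(3) unfolding outer_nbhds_def by (simp add: card_insert_if)
    show ?case
    proof (cases "w = v")
      case True
      have "layout k E V ({x} \<union> {v})"
        using xv single with_v[of "{v}"] layout_single True
        by (intro layout.intros) (auto simp: insert_commute)
      with True show ?thesis by (simp add: insert_commute)
    next
      case False
      then show ?thesis
        using layout_single single by (auto intro: layout.layout_single)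
    qed
  next
    case (layout_join A B)
    have sub: "A \<subseteq> V - {x}" "B \<subseteq> V - {x}" "finite A" "finite B"
      using layout_join layout_subset by blast+
    consider "v \<in> A" "v \<notin> B" | "v \<notin> A" "v \<in> B" | "v \<notin> A" "v \<notin> B"
      using layout_join.hyps by blast
    then show ?case
    proof cases
      case 1
      then have "layout k E V (insert x A \<union> B)"
        using layout_join sub with_v[of "A \<union> B"]
        by (intro layout.layout_join) auto
      with 1 show ?thesis by simp
    next
      case 2
      then have "layout k E V (A \<union> insert x B)"
        using layout_join sub with_v[of "A \<union> B"]
        by (intro layout.layout_join) auto
      with 2 show ?thesis by simp
    next
      case 3
      then show ?thesis
        using layout_join sub without_v[of "A \<union> B"] by (auto intro!: layout.layout_join)
    qed
  qed
qed

lemma layout_width_le_prune: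
  assumes "finite V" and sym: "\<And>x y. E x y \<Longrightarrow> E y x"
    and "\<And>W. W \<subseteq> V \<Longrightarrow> card W \<ge> 2 \<Longrightarrow> \<exists>x v. prunable W E x v"
  shows "layout_width_le 2 V E"
proof -
  have "layout_width_le 2 W E" if "W \<subseteq> V" for W
    using finite_subset[OF that assms(1)] that
  proof (induction W rule: finite_psubset_induct)
    case (psubset W)
    consider "W = {}" | v where "W = {v}" | "card W \<ge> 2"
      using psubset.hyps by (metis One_nat_def Suc_leI card_1_singletonE card_gt_0_iff le_neq_implies_less
          nat_1_add_1 plus_1_eq_Suc)
    then show ?case
    proof cases
      case 2
      have "card (outer_nbhds E {v} {v}) \<le> 2"
        by simp
      with 2 show ?thesis
        by (auto simp: layout_width_le_def intro!: layout_single)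
    next
      case 3
      then obtain x v where p: "prunable W E x v"
        using assms(3) psubset.prems by blast
      then have x: "x \<in> W" "v \<in> W - {x}"
        by (auto simp: prunable_def)
      then have "layout_width_le 2 (W - {x}) E"
        using psubset.IH[of "W - {x}"] psubset.prems by blast
      with x have "layout 2 E (W - {x}) (W - {x})"
        by (auto simp: layout_width_le_def)
      from layout_prunable[OF p sym _ this] show ?thesis
        using x by (simp add: layout_width_le_def insert_absorb)
    qed (simp add: layout_width_le_def)
  qed
  then show ?thesis by blast
qed

section \<open>Clique-width of layouts\<close>

definition induced_graph :: "('a \<Rightarrow> 'a \<Rightarrow> bool) \<Rightarrow> 'a set \<Rightarrow> 'a pair_pre_digraph" where
  "induced_graph E X = \<lparr> pverts = X, parcs = {(u, v). u \<in> X \<and> v \<in> X \<and> E u v} \<rparr>"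

text \<open>Disjointness of \<open>S\<close> and its image ensures that successive relabellings
  never move a vertex twice. The map \<open>g\<close> may merge labels.\<close>

lemma cw_constructs_relabel_fresh:
  assumes "cw_constructs n G l" "finite S" "S \<subseteq> {..<n}" "g ` S \<subseteq> {..<n}" "g ` S \<inter> S = {}"
  shows "cw_constructs n G (\<lambda>v. if l v \<in> S then g (l v) else l v)"
  using assms(2-)
proof (induction S rule: finite_induct)
  case empty
  then show ?case using assms(1) by simp
next
  case (insert i S)
  let ?l = "\<lambda>v. if l v \<in> S then g (l v) else l v"
  have "cw_constructs n G ?l"
    using insert by auto
  then have "cw_constructs n G (\<lambda>v. if ?l v = i then g i else ?l v)"
    using insert.prems by (intro relabel) auto
  moreover have "(\<lambda>v. if ?l v = i then g i else ?l v) =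
      (\<lambda>v. if l v \<in> insert i S then g (l v) else l v)"
    using insert.prems insert.hyps by (auto simp: fun_eq_iff)
  ultimately show ?case by simp
qed

lemma cw_constructs_joins:
  assumes "cw_constructs n \<lparr> pverts = W, parcs = R \<rparr> l" "finite J"
    and "\<And>i j. (i, j) \<in> J \<Longrightarrow> i < n \<and> j < n \<and> i \<noteq> j"
  shows "cw_constructs n \<lparr> pverts = W,
    parcs = R \<union> {(u, v). u \<in> W \<and> v \<in> W \<and> ((l u, l v) \<in> J \<or> (l v, l u) \<in> J)} \<rparr> l"
  using assms(2,3)
proof (induction J rule: finite_induct)
  case empty
  then show ?case using assms(1) by simp
next
  case (insert p J)
  obtain i j where p: "p = (i, j)" by (cases p)
  let ?R = "R \<union> {(u, v). u \<in> W \<and> v \<in> W \<and> ((l u, l v) \<in> J \<or> (l v, l u) \<in> J)}"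
  have "cw_constructs n \<lparr> pverts = W, parcs = ?R \<rparr> l"
    using insert.IH insert.prems by auto
  moreover have "i < n" "j < n" "i \<noteq> j"
    using insert.prems[of i j] p by auto
  ultimately have "cw_constructs n \<lparr> pverts = W, parcs = ?R \<union>
      {(u, v). u \<in> W \<and> v \<in> W \<and> (l u = i \<and> l v = j \<or> l u = j \<and> l v = i)} \<rparr> l"
    using label_join[of n "\<lparr> pverts = W, parcs = ?R \<rparr>" l i j] by simp
  moreover have "?R \<union> {(u, v). u \<in> W \<and> v \<in> W \<and> (l u = i \<and> l v = j \<or> l u = j \<and> l v = i)} =
      R \<union> {(u, v). u \<in> W \<and> v \<in> W \<and> ((l u, l v) \<in> insert p J \<or> (l v, l u) \<in> insert p J)}"
    using p by auto
  ultimately show ?case by simp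
qed

lemma layout_cw_constructs:
  assumes sym: "\<And>x y. E x y \<Longrightarrow> E y x" and irrefl: "\<And>x. \<not> E x x" and "layout k E V X"
  shows "\<exists>l. cw_constructs (3 * k) (induced_graph E X) l \<and> (\<forall>x\<in>X. l x < k) \<and>
    (\<forall>x\<in>X. \<forall>y\<in>X. l x = l y \<longrightarrow> {z \<in> V - X. E x z} = {z \<in> V - X. E y z})"
  using assms(3)
proof (induction rule: layout.induct)
  case (layout_single v)
  have "card (outer_nbhds E V {v}) > 0"
    using finite_outer_nbhds[of "{v}" E V] empty_in_outer_nbhds[of E V "{v}"] card_gt_0_iff by blast
  then have "k > 0"
    using layout_single(2) by simp
  moreover have "induced_graph E {v} = \<lparr> pverts = {v}, parcs = {} \<rparr>"
    using irrefl by (auto simp: induced_graph_def)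
  ultimately show ?case
    using single_vertex[of 0 "3 * k" v] by (intro exI[of _ "\<lambda>_. 0"]) auto
next
  case (layout_join A B)
  from layout_join.IH(1) obtain a where a': "cw_constructs (3 * k) (induced_graph E A) a \<and> (\<forall>x\<in>A. a x < k) \<and>
      (\<forall>x\<in>A. \<forall>y\<in>A. a x = a y \<longrightarrow> {z \<in> V - A. E x z} = {z \<in> V - A. E y z})"
    by (rule exE)
  note a = a'[THEN conjunct1] a'[THEN conjunct2, THEN conjunct1, rule_format]
    a'[THEN conjunct2, THEN conjunct2, rule_format]
  from layout_join.IH(2) obtain b where b': "cw_constructs (3 * k) (induced_graph E B) b \<and> (\<forall>x\<in>B. b x < k) \<and>
      (\<forall>x\<in>B. \<forall>y\<in>B. b x = b y \<longrightarrow> {z \<in> V - B. E x z} = {z \<in> V - B. E y z})"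
    by (rule exE)
  note b = b'[THEN conjunct1] b'[THEN conjunct2, THEN conjunct1, rule_format]
    b'[THEN conjunct2, THEN conjunct2, rule_format]
  have fin: "finite A" "finite B" "A \<subseteq> V" "B \<subseteq> V"
    using layout_subset layout_join.hyps by blast+
  let ?X = "A \<union> B"
  let ?b = "\<lambda>v. if b v \<in> {..<k} then b v + k else b v"
  define l where "l = (\<lambda>v. if v \<in> A then a v else ?b v)"
  have "cw_constructs (3 * k) (induced_graph E B) ?b"
    by (rule cw_constructs_relabel_fresh[OF b(1)]) auto
  from label_union[OF a(1) this]
  have union: "cw_constructs (3 * k) \<lparr> pverts = ?X,
      parcs = parcs (induced_graph E A) \<union> parcs (induced_graph E B) \<rparr> l"
    unfolding l_def by (simp add: induced_graph_def layout_join.hyps)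
  have lA: "l x = a x" if "x \<in> A" for x
    using that by (simp add: l_def)
  have lB: "l x = b x + k" if "x \<in> B" for x
    using that b(2)[of x] layout_join.hyps(3) by (auto simp: l_def)
  \<comment> \<open>One join for every pair of labels realised by an edge between \<open>A\<close>
    and \<open>B\<close>. By the invariants of both parts, either all pairs with these two labels
    are edges or none, so no wrong edge arises.\<close>
  let ?J = "{(a x, b y + k) | x y. x \<in> A \<and> y \<in> B \<and> E x y}"
  have J: "(l x, l y) \<in> ?J \<longleftrightarrow> x \<in> A \<and> y \<in> B \<and> E x y" if xy: "x \<in> ?X" "y \<in> ?X" for x y
  proof
    assume "(l x, l y) \<in> ?J"
    then obtain x' y' where J: "l x = a x'" "l y = b y' + k" and e: "x' \<in> A" "y' \<in> B" "E x' y'"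
      by blast
    have x: "x \<in> A"
      using J(1) a(2)[OF e(1)] lB[of x] xy(1) by fastforce
    have y: "y \<in> B"
      using J(2) a(2)[of y] lA[of y] xy(2) by fastforce
    have disj: "x \<in> V - B" "y' \<in> V - A"
      using x e(2) fin layout_join.hyps(3) by blast+
    have "a x = a x'" "b y = b y'"
      using J lA[OF x] lB[OF y] by simp_all
    then have "E x y'" "E y' x \<longrightarrow> E y x"
      using a(3)[OF x e(1)] b(3)[OF y e(2)] e(3) disj by blast+
    then show "x \<in> A \<and> y \<in> B \<and> E x y"
      using x y sym by blast
  next
    assume "x \<in> A \<and> y \<in> B \<and> E x y"
    then show "(l x, l y) \<in> ?J"
      using lA[of x] lB[of y] by fastforce
  qed
  have "finite ?J"
    by (rule finite_subset[of _ "(\<lambda>(x, y). (a x, b y + k)) ` (A \<times> B)"]) (use fin in auto)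
  moreover have "i < 3 * k \<and> j < 3 * k \<and> i \<noteq> j" if "(i, j) \<in> ?J" for i j
    using that a(2) b(2) by fastforce
  ultimately have joined: "cw_constructs (3 * k) \<lparr> pverts = ?X,
      parcs = parcs (induced_graph E A) \<union> parcs (induced_graph E B) \<union>
        {(u, v). u \<in> ?X \<and> v \<in> ?X \<and> ((l u, l v) \<in> ?J \<or> (l v, l u) \<in> ?J)} \<rparr> l"
    by (rule cw_constructs_joins[OF union])
  have "parcs (induced_graph E A) \<union> parcs (induced_graph E B) \<union>
      {(u, v). u \<in> ?X \<and> v \<in> ?X \<and> ((l u, l v) \<in> ?J \<or> (l v, l u) \<in> ?J)} =
      {(u, v). u \<in> ?X \<and> v \<in> ?X \<and> E u v}" (is "?P = ?Q")
  proof (rule set_eqI)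
    fix p :: "'a \<times> 'a"
    obtain u v where p: "p = (u, v)" by (cases p)
    show "p \<in> ?P \<longleftrightarrow> p \<in> ?Q"
    proof (cases "u \<in> ?X \<and> v \<in> ?X")
      case True
      then have "p \<in> ?P \<longleftrightarrow> u \<in> A \<and> v \<in> A \<and> E u v \<or> u \<in> B \<and> v \<in> B \<and> E u v \<or>
          (u \<in> A \<and> v \<in> B \<and> E u v) \<or> (v \<in> A \<and> u \<in> B \<and> E v u)"
        using J[of u v] J[of v u] p unfolding induced_graph_def by simp
      also have "\<dots> \<longleftrightarrow> p \<in> ?Q"
        using True p sym by blast
      finally show ?thesis .
    qed (use p in \<open>auto simp: induced_graph_def\<close>)
  qed
  with joined have G: "cw_constructs (3 * k) (induced_graph E ?X) l"
    by (simp add: induced_graph_def)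
  have l_less: "l x < 2 * k" if "x \<in> ?X" for x
    using that a(2)[of x] b(2)[of x] lA[of x] lB[of x] by fastforce
  let ?N = "\<lambda>x. {z \<in> V - ?X. E x z}"
  have l_eq: "?N x = ?N y" if xy: "x \<in> ?X" "y \<in> ?X" "l x = l y" for x y
  proof (cases "x \<in> A")
    case True
    then have "y \<in> A"
      using xy a(2)[of x] lA[of x] lB[of y] by fastforce
    then have "{z \<in> V - A. E x z} = {z \<in> V - A. E y z}"
      using a(3)[of x y] True xy lA by simp
    then show ?thesis by blast
  next
    case False
    then have "x \<in> B" using xy by blast
    then have "y \<in> B"
      using xy a(2)[of y] lA[of y] lB[of x] by fastforce
    then have "{z \<in> V - B. E x z} = {z \<in> V - B. E y z}"
      using b(3)[of x y] \<open>x \<in> B\<close> xy lB by simp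
    then show ?thesis by blast
  qed
  have "finite (outer_nbhds E V ?X)"
    using fin by (simp add: finite_outer_nbhds)
  from card_le_inj[OF this, of "{..<k}"] layout_join.hyps(4) obtain idx :: "'a set \<Rightarrow> nat"
    where idx: "idx ` outer_nbhds E V ?X \<subseteq> {..<k}" "inj_on idx (outer_nbhds E V ?X)"
    by auto
  have idx_less: "idx (?N x) < k" if "x \<in> ?X" for x
    using idx(1) nbhd_in_outer_nbhds[OF that, of V E] by blast
  \<comment> \<open>The new label has to be a function of the old one, so the neighbourhood is read
    off a representative; \<open>l_eq\<close> makes the choice harmless.\<close>
  define rep where "rep = (\<lambda>i. SOME x. x \<in> ?X \<and> l x = i)"
  define g where "g = (\<lambda>i. 2 * k + idx (?N (rep i)))"
  have rep: "rep (l x) \<in> ?X \<and> l (rep (l x)) = l x" if "x \<in> ?X" for x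
    unfolding rep_def by (rule someI[of "\<lambda>y. y \<in> ?X \<and> l y = l x" x]) (use that in simp)
  then have g: "g (l x) = 2 * k + idx (?N x)" if "x \<in> ?X" for x
    using that l_eq[of "rep (l x)" x] by (simp only: g_def)
  \<comment> \<open>Relabelling directly into \<open>{..<k}\<close> could collide with labels still
    in use, hence the detour through the block from \<open>2 * k\<close> to
    \<open>3 * k\<close>.\<close>
  define l1 where "l1 = (\<lambda>v. if l v \<in> l ` ?X then g (l v) else l v)"
  have G1: "cw_constructs (3 * k) (induced_graph E ?X) l1"
    unfolding l1_def
  proof (rule cw_constructs_relabel_fresh[OF G])
    have "g (l x) < 3 * k \<and> 2 * k \<le> g (l x)" if "x \<in> ?X" for x
      using g[OF that] idx_less[OF that] by linarith
    then have g_img: "g i < 3 * k \<and> 2 * k \<le> g i" if "i \<in> l ` ?X" for i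
      using that by (elim imageE) metis
    then show "g ` l ` ?X \<subseteq> {..<3 * k}"
      by (intro image_subsetI) (simp only: lessThan_iff)
    have l_img: "i < 2 * k" if "i \<in> l ` ?X" for i
      using that l_less by (elim imageE) metis
    then show "l ` ?X \<subseteq> {..<3 * k}"
      by fastforce
    show "g ` l ` ?X \<inter> l ` ?X = {}"
    proof (rule equals0I)
      fix i assume "i \<in> g ` l ` ?X \<inter> l ` ?X"
      then obtain j where "j \<in> l ` ?X" "i = g j" "i \<in> l ` ?X"
        by (elim IntE imageE[of _ g])
      then show False
        using g_img[of j] l_img[of i] by linarith
    qed
  qed (use fin in simp)
  define l2 where "l2 = (\<lambda>v. if l1 v \<in> {2 * k..<3 * k} then l1 v - 2 * k else l1 v)"
  have "cw_constructs (3 * k) (induced_graph E ?X) l2"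
    unfolding l2_def by (rule cw_constructs_relabel_fresh[OF G1]) auto
  moreover have l2: "l2 x = idx (?N x)" if "x \<in> ?X" for x
  proof -
    have "l1 x = 2 * k + idx (?N x)"
      using g[OF that] that by (simp add: l1_def)
    then show ?thesis
      using idx_less[OF that] by (simp add: l2_def)
  qed
  moreover have "?N x = ?N y" if xy: "x \<in> ?X" "y \<in> ?X" "l2 x = l2 y" for x y
  proof (rule inj_onD[OF idx(2)])
    show "idx (?N x) = idx (?N y)"
      using l2[OF xy(1)] l2[OF xy(2)] xy(3) by simp
  qed (rule nbhd_in_outer_nbhds, fact)+
  moreover have "l2 x < k" if "x \<in> ?X" for x
    using l2[OF that] idx_less[OF that] by simp
  ultimately show ?case
    by (intro exI[of _ l2] conjI ballI impI) blast+
qed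

lemma clique_width_le_layout_width:
  assumes "pair_graph G" "layout_width_le k (pverts G) (\<lambda>u v. (u, v) \<in> parcs G)"
  shows "clique_width G \<le> 3 * k"
proof (cases "pverts G = {}")
  case False
  have G: "sym (parcs G)" "irrefl (parcs G)" "parcs G \<subseteq> pverts G \<times> pverts G"
    using assms(1) by (auto simp: pair_graph_iff)
  have "layout k (\<lambda>u v. (u, v) \<in> parcs G) (pverts G) (pverts G)"
    using assms(2) False by (simp add: layout_width_le_def)
  then obtain l where "cw_constructs (3 * k) (induced_graph (\<lambda>u v. (u, v) \<in> parcs G) (pverts G)) l"
    using layout_cw_constructs[of "\<lambda>u v. (u, v) \<in> parcs G" k "pverts G" "pverts G"] G(1,2)
    by (auto simp: sym_def irrefl_def)
  moreover have "induced_graph (\<lambda>u v. (u, v) \<in> parcs G) (pverts G) = G"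
    using G(3) by (intro pair_pre_digraph.equality) (auto simp: induced_graph_def)
  ultimately have "\<exists>l. cw_constructs (3 * k) G l"
    by auto
  then show ?thesis
    using False by (auto simp: clique_width_def intro: Least_le)
qed (simp add: clique_width_def)

section \<open>Chordal graphs\<close>

text \<open>Reflexive at every vertex, also outside \<open>W\<close>; whoever concludes membership
  in \<open>W\<close> has to know it of the starting vertex.\<close>

definition connected_in :: "('a \<Rightarrow> 'a \<Rightarrow> bool) \<Rightarrow> 'a set \<Rightarrow> 'a \<Rightarrow> 'a \<Rightarrow> bool" where
  "connected_in E W = (\<lambda>x y. x \<in> W \<and> y \<in> W \<and> E x y)\<^sup>*\<^sup>*"

lemma connected_in_refl [simp]: "connected_in E W x x"
  by (simp add: connected_in_def)

lemma connected_in_step: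
  "connected_in E W x y \<Longrightarrow> y \<in> W \<Longrightarrow> z \<in> W \<Longrightarrow> E y z \<Longrightarrow> connected_in E W x z"
  unfolding connected_in_def by (rule rtranclp.rtrancl_into_rtrancl) auto

lemma connected_in_trans:
  "connected_in E W x y \<Longrightarrow> connected_in E W y z \<Longrightarrow> connected_in E W x z"
  unfolding connected_in_def by (rule rtranclp_trans)

lemma connected_in_mono: "connected_in E W x y \<Longrightarrow> W \<subseteq> W' \<Longrightarrow> connected_in E W' x y"
  unfolding connected_in_def by (erule rtranclp_mono[THEN predicate2D, rotated]) blast

lemma connected_in_closed:
  assumes "connected_in E W x y" "x \<in> T"
    and "\<And>y z. y \<in> T \<Longrightarrow> y \<in> W \<Longrightarrow> z \<in> W \<Longrightarrow> E y z \<Longrightarrow> z \<in> T"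
  shows "y \<in> T"
  using assms(1) unfolding connected_in_def
  by (induction rule: rtranclp_induct) (use assms(2,3) in blast)+

lemma connected_in_subset: "connected_in E W x y \<Longrightarrow> x \<in> W \<Longrightarrow> y \<in> W"
  by (erule connected_in_closed) auto

definition induced_path :: "('a \<Rightarrow> 'a \<Rightarrow> bool) \<Rightarrow> 'a set \<Rightarrow> 'a \<Rightarrow> 'a \<Rightarrow> 'a list \<Rightarrow> bool" where
  "induced_path E W u v xs \<longleftrightarrow> xs \<noteq> [] \<and> set xs \<subseteq> W \<and> xs ! 0 = u \<and> xs ! (length xs - 1) = v \<and>
     distinct xs \<and> (\<forall>i<length xs. \<forall>j<length xs. E (xs ! i) (xs ! j) \<longleftrightarrow> j = Suc i \<or> i = Suc j)"

text \<open>A walk is followed step by step. If its next vertex \<open>z\<close> is already on the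
  path, the path is cut there; otherwise it is cut at its first vertex adjacent to \<open>z\<close>,
  and \<open>z\<close> is appended.\<close>

lemma induced_path_exists:
  assumes sym: "\<And>x y. E x y \<Longrightarrow> E y x" and irrefl: "\<And>x. \<not> E x x"
    and "u \<in> W" "connected_in E W u v"
  shows "\<exists>xs. induced_path E W u v xs"
  using assms(4) unfolding connected_in_def
proof (induction rule: rtranclp_induct)
  case base
  then show ?case
    using assms(3) irrefl by (intro exI[of _ "[u]"]) (auto simp: induced_path_def)
next
  case (step y z)
  then obtain xs where xs: "induced_path E W u y xs" by blast
  show ?case
  proof (cases "z \<in> set xs")
    case True
    then obtain j where "j < length xs" "xs ! j = z"
      by (meson in_set_conv_nth)
    then have "induced_path E W u z (take (Suc j) xs)"
      using xs unfolding induced_path_def by (auto dest: in_set_takeD)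
    then show ?thesis ..
  next
    case False
    define i where "i = (LEAST i. i < length xs \<and> E (xs ! i) z)"
    have "length xs - 1 < length xs \<and> E (xs ! (length xs - 1)) z"
      using xs step.hyps by (auto simp: induced_path_def)
    then have "i < length xs \<and> E (xs ! i) z"
      unfolding i_def by (rule LeastI)
    then have i: "i < length xs" "E (xs ! i) z"
      by auto
    have least: "\<not> E (xs ! j) z" if "j < i" for j
      using that i(1) not_less_Least[of j "\<lambda>i. i < length xs \<and> E (xs ! i) z"]
      unfolding i_def[symmetric] by simp
    let ?ys = "take (Suc i) xs @ [z]"
    have len: "length ?ys = Suc (Suc i)"
      using i(1) by simp
    have nth: "?ys ! j = (if j \<le> i then xs ! j else z)" if "j < length ?ys" for j
      using that i(1) by (auto simp: nth_append)
    have "E (?ys ! a) (?ys ! b) \<longleftrightarrow> b = Suc a \<or> a = Suc b"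
      if ab: "a < length ?ys" "b < length ?ys" for a b
    proof -
      have zE: "E (xs ! a) z \<longleftrightarrow> a = i" if "a \<le> i" for a
        using that least[of a] i(2) by (cases "a = i") auto
      consider "a \<le> i" "b \<le> i" | "a \<le> i" "b = Suc i" | "a = Suc i" "b \<le> i" | "a = Suc i" "b = Suc i"
        using ab len by linarith
      then show ?thesis
      proof cases
        case 1
        then show ?thesis
          using xs ab i(1) nth by (auto simp: induced_path_def)
      next
        case 2
        then show ?thesis using zE[of a] ab nth by auto
      next
        case 3
        then show ?thesis using zE[of b] ab nth sym by fastforce
      next
        case 4
        then show ?thesis using ab nth irrefl by auto
      qed
    qed
    moreover have "distinct ?ys"
      using xs False by (auto simp: induced_path_def dest: in_set_takeD)
    moreover have "set ?ys \<subseteq> W"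
      using xs step.hyps by (auto simp: induced_path_def dest: in_set_takeD)
    moreover have "?ys ! 0 = u" "?ys ! (length ?ys - 1) = z"
      using nth[of 0] nth[of "Suc i"] xs len by (auto simp: induced_path_def)
    ultimately have "induced_path E W u z ?ys"
      unfolding induced_path_def by blast
    then show ?thesis ..
  qed
qed

text \<open>The vertices \<open>a\<close>, \<open>b\<close> have degree three and \<open>c\<close>,
  \<open>d\<close> are the nonadjacent tips, an order kept throughout. The remaining distinctness
  follows from irreflexivity of \<open>E\<close>.\<close>

definition diamond :: "('a \<Rightarrow> 'a \<Rightarrow> bool) \<Rightarrow> 'a \<Rightarrow> 'a \<Rightarrow> 'a \<Rightarrow> 'a \<Rightarrow> bool" where
  "diamond E a b c d \<longleftrightarrow> E a b \<and> E a c \<and> E a d \<and> E b c \<and> E b d \<and> c \<noteq> d \<and> \<not> E c d"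

definition diamond_free :: "'a set \<Rightarrow> ('a \<Rightarrow> 'a \<Rightarrow> bool) \<Rightarrow> bool" where
  "diamond_free V E \<longleftrightarrow> \<not> (\<exists>a\<in>V. \<exists>b\<in>V. \<exists>c\<in>V. \<exists>d\<in>V. diamond E a b c d)"

definition hole_free :: "'a set \<Rightarrow> ('a \<Rightarrow> 'a \<Rightarrow> bool) \<Rightarrow> bool" where
  "hole_free V E \<longleftrightarrow> (\<forall>n\<ge>4. \<not> (\<exists>f. inj_on f {..<n} \<and> f ` {..<n} \<subseteq> V \<and>
     (\<forall>i<n. \<forall>j<n. E (f i) (f j) \<longleftrightarrow> j = Suc i mod n \<or> i = Suc j mod n)))"

lemma diamond_freeD:
  "diamond_free V E \<Longrightarrow> diamond E a b c d \<Longrightarrow> a \<in> V \<Longrightarrow> b \<in> V \<Longrightarrow> c \<in> V \<Longrightarrow> d \<in> V \<Longrightarrow> False"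
  unfolding diamond_free_def by blast

lemma diamond_free_subset: "diamond_free V E \<Longrightarrow> W \<subseteq> V \<Longrightarrow> diamond_free W E"
  unfolding diamond_free_def by blast

section \<open>Consequences of the absence of holes\<close>

locale chordal_adj =
  fixes V :: "'a set" and E :: "'a \<Rightarrow> 'a \<Rightarrow> bool"
  assumes finite_V: "finite V" and E_sym: "E x y \<Longrightarrow> E y x" and E_irrefl: "\<not> E x x"
    and hole_free: "hole_free V E"
begin

lemma chordal_adj_subset:
  assumes "W \<subseteq> V"
  shows "chordal_adj W E"
proof
  show "hole_free W E"
    using hole_free assms unfolding hole_free_def by (meson subset_trans)
qed (use finite_subset[OF assms finite_V] E_sym E_irrefl in auto)

text \<open>A shortest \<open>u\<close>-\<open>v\<close> path avoiding the other neighbours of \<open>x\<close> would close a hole through \<open>x\<close>.\<close>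
lemma no_detour:
  assumes "x \<in> V" "u \<in> V" "v \<in> V" "E x u" "E x v" "u \<noteq> v" "\<not> E u v"
    and W: "W = {y \<in> V. y \<noteq> x \<and> \<not> E x y}"
    and "w \<in> W" "w' \<in> W" "E u w" "E w' v" "connected_in E W w w'"
  shows False
proof -
  let ?W = "W \<union> {u, v}"
  have "connected_in E ?W u w"
    using assms(9,11) by (intro connected_in_step[OF connected_in_refl]) auto
  moreover have "connected_in E ?W w w'"
    by (rule connected_in_mono[OF assms(13)]) blast
  moreover have "connected_in E ?W w' v"
    using assms(10,12) by (intro connected_in_step[OF connected_in_refl]) auto
  ultimately have "connected_in E ?W u v"
    by (blast intro: connected_in_trans)
  then obtain xs where xs: "induced_path E ?W u v xs"
    using induced_path_exists[of E u ?W v] E_sym E_irrefl by blast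
  define n where "n = length xs"
  have adj: "E (xs ! i) (xs ! j) \<longleftrightarrow> j = Suc i \<or> i = Suc j" if "i < n" "j < n" for i j
    using xs that by (simp add: induced_path_def n_def)
  have ends: "xs ! 0 = u" "xs ! (n - 1) = v" "n > 0" and dist: "distinct xs"
    and sub: "set xs \<subseteq> ?W"
    using xs by (auto simp: induced_path_def n_def)
  have "n \<noteq> 1" using ends assms(6) by auto
  moreover have "n \<noteq> 2"
  proof
    assume n2: "n = 2"
    with adj[of 0 1] have "E u v" using ends by simp
    then show False using assms(7) by simp
  qed
  ultimately have n: "n \<ge> 3" using ends(3) by linarith
  \<comment> \<open>The hole is the path followed by \<open>x\<close> in position \<open>n\<close>;
    its length \<open>Suc n\<close> is at least 4 because \<open>u\<close> and \<open>v\<close> are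
    distinct and nonadjacent.\<close>
  let ?f = "\<lambda>i. if i < n then xs ! i else x"
  have x: "x \<notin> set xs"
    using sub W assms(4,5) E_irrefl by auto
  have x_adj: "E x (xs ! i) \<longleftrightarrow> i = 0 \<or> i = n - 1" if "i < n" for i
  proof
    assume "E x (xs ! i)"
    then have "xs ! i = u \<or> xs ! i = v"
      using subsetD[OF sub nth_mem[of i xs]] that W by (auto simp: n_def)
    then show "i = 0 \<or> i = n - 1"
      using ends that dist unfolding n_def by (metis diff_less nth_eq_iff_index_eq zero_less_one)
  next
    assume "i = 0 \<or> i = n - 1"
    then show "E x (xs ! i)"
      using ends assms(4,5) by auto
  qed
  have "inj_on ?f {..<Suc n}"
    using dist x by (auto simp: inj_on_def n_def nth_eq_iff_index_eq less_Suc_eq)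
  moreover have "?f ` {..<Suc n} \<subseteq> V"
  proof -
    have "xs ! i \<in> V" if "i < n" for i
      using subsetD[OF sub nth_mem[of i xs]] that W assms(2,3) by (auto simp: n_def)
    then show ?thesis using assms(1) by auto
  qed
  moreover have "E (?f i) (?f j) \<longleftrightarrow> j = Suc i mod Suc n \<or> i = Suc j mod Suc n"
    if ij: "i < Suc n" "j < Suc n" for i j
  proof -
    consider "i < n" "j < n" | "i < n" "j = n" | "i = n" "j < n" | "i = n" "j = n"
      using ij unfolding less_Suc_eq by blast
    then show ?thesis
    proof cases
      case 1
      then show ?thesis using adj by simp
    next
      case 2
      then show ?thesis using x_adj[of i] E_sym n by auto
    next
      case 3
      then show ?thesis using x_adj[of j] n by auto
    next
      case 4
      then show ?thesis using E_irrefl n by simp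
    qed
  qed
  ultimately have "\<exists>f. inj_on f {..<Suc n} \<and> f ` {..<Suc n} \<subseteq> V \<and>
      (\<forall>i<Suc n. \<forall>j<Suc n. E (f i) (f j) \<longleftrightarrow> j = Suc i mod Suc n \<or> i = Suc j mod Suc n)"
    by (intro exI[of _ ?f] conjI allI impI)
  moreover have "Suc n \<ge> 4"
    using n by simp
  ultimately show False
    using hole_free unfolding hole_free_def by blast
qed

text \<open>The shortest case of \<open>no_detour\<close>: the detour from \<open>b\<close> to
  \<open>d\<close> is the single vertex \<open>c\<close>.\<close>

lemma no_C4:
  assumes "a \<in> V" "b \<in> V" "c \<in> V" "d \<in> V" "E a b" "E b c" "E c d" "E d a" "a \<noteq> c" "b \<noteq> d"
  shows "E a c \<or> E b d"
proof (rule ccontr)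
  assume "\<not> (E a c \<or> E b d)"
  then show False
    using assms E_sym no_detour[of a b d "{y \<in> V. y \<noteq> a \<and> \<not> E a y}" c c] by auto
qed

text \<open>If \<open>m\<close> missed the successor, the path up to the next neighbour of
  \<open>m\<close> would be a detour between two nonadjacent neighbours of \<open>m\<close>.
  Iterated, this makes a vertex adjacent to both ends adjacent to the whole path.\<close>

lemma fan_step:
  assumes xs: "induced_path E W u v xs" and "W \<subseteq> V" "m \<in> V" "m \<notin> W"
    and "E m v" "Suc a < length xs" "E m (xs ! a)"
  shows "E m (xs ! Suc a)"
proof (rule ccontr)
  assume no: "\<not> E m (xs ! Suc a)"
  define n where "n = length xs"
  have adj: "E (xs ! i) (xs ! j) \<longleftrightarrow> j = Suc i \<or> i = Suc j" if "i < n" "j < n" for i j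
    using xs that by (simp add: induced_path_def n_def)
  have xsV: "xs ! i \<in> V" "xs ! i \<noteq> m" if "i < n" for i
  proof -
    have "xs ! i \<in> W"
      using xs that nth_mem[of i xs] unfolding induced_path_def n_def by blast
    then show "xs ! i \<in> V" "xs ! i \<noteq> m"
      using assms(2,4) by auto
  qed
  define i where "i = (LEAST i. a < i \<and> i < n \<and> E m (xs ! i))"
  have "a < n - 1 \<and> n - 1 < n \<and> E m (xs ! (n - 1))"
    using xs assms(5,6) by (auto simp: induced_path_def n_def)
  then have "a < i \<and> i < n \<and> E m (xs ! i)"
    unfolding i_def by (rule LeastI)
  moreover from this have "i \<noteq> Suc a"
    using no by auto
  ultimately have i: "Suc a < i" "i < n" "E m (xs ! i)"
    by auto
  have between: "\<not> E m (xs ! j)" if "a < j" "j < i" for j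
    using that i not_less_Least[of j "\<lambda>i. a < i \<and> i < n \<and> E m (xs ! i)"] unfolding i_def[symmetric] by auto
  let ?W = "{y \<in> V. y \<noteq> m \<and> \<not> E m y}"
  have W: "xs ! j \<in> ?W" if "a < j" "j < i" for j
    using that between xsV[of j] i by auto
  have conn: "connected_in E ?W (xs ! Suc a) (xs ! (Suc a + j))" if "Suc a + j < i" for j
    using that
  proof (induction j)
    case (Suc j)
    then show ?case
      using connected_in_step[of E ?W "xs ! Suc a" "xs ! (Suc a + j)" "xs ! (Suc a + Suc j)"]
        W[of "Suc a + j"] W[of "Suc a + Suc j"] adj[of "Suc a + j" "Suc a + Suc j"] i by auto
  qed simp
  have pred: "Suc a + (i - 1 - Suc a) = i - 1" "i - 1 < i"
    using i by linarith+
  have "connected_in E ?W (xs ! Suc a) (xs ! (i - 1))"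
    using conn[of "i - 1 - Suc a"] pred by (simp only:)
  moreover have "xs ! a \<noteq> xs ! i"
    using xs i assms(6) by (auto simp: induced_path_def n_def nth_eq_iff_index_eq)
  moreover have "\<not> E (xs ! a) (xs ! i)" "E (xs ! a) (xs ! Suc a)" "E (xs ! (i - 1)) (xs ! i)"
    using adj[of a i] adj[of a "Suc a"] adj[of "i - 1" i] i by auto
  ultimately show False
    using no_detour[of m "xs ! a" "xs ! i" ?W "xs ! Suc a" "xs ! (i - 1)"] assms(3,7) i
      xsV[of a] xsV[of i] W[of "Suc a"] W[of "i - 1"] by auto
qed

text \<open>Every walk from \<open>u\<close> stays in \<open>?T \<union> ?S\<close>, where
  \<open>?T\<close> is the clique of neighbours of \<open>z\<close> around \<open>u\<close> and
  \<open>?S\<close> the non-neighbours of \<open>z\<close> reached from \<open>?T\<close>.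
  Diamond-freeness prevents leaving \<open>?T\<close> inside the neighbourhood of \<open>z\<close>,
  and \<open>no_detour\<close> prevents a passage from \<open>?S\<close> to a neighbour of
  \<open>z\<close> outside \<open>?T\<close>.\<close>

lemma diamond_free_cut_vertex:
  assumes df: "diamond_free V E" and V: "z \<in> V" "u \<in> V" "y \<in> V"
    and "E z u" "E z y" "u \<noteq> y" "\<not> E u y"
  shows "\<not> connected_in E (V - {z}) u y"
proof
  assume conn: "connected_in E (V - {z}) u y"
  let ?W = "{w \<in> V. w \<noteq> z \<and> \<not> E z w}"
  let ?T = "{v \<in> V. E z v \<and> (v = u \<or> E v u)}"
  let ?S = "{w. \<exists>v\<in>?T. \<exists>w0\<in>?W. w \<in> ?W \<and> E v w0 \<and> connected_in E ?W w0 w}"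
  have close: "w \<in> ?T" if "v \<in> ?T" "w \<in> V" "E z w" "E v w" for v w
  proof (cases "v = u \<or> w = u \<or> E w u")
    case False
    then have "diamond E z v u w"
      using that assms(5) E_sym unfolding diamond_def by auto
    then show ?thesis
      using diamond_freeD[OF df] that V by blast
  qed (use that E_sym in auto)
  have "y \<in> ?T \<union> ?S"
  proof (rule connected_in_closed[OF conn])
    show "u \<in> ?T \<union> ?S"
      using V assms(5) by simp
    fix w w' assume w: "w \<in> ?T \<union> ?S" "w \<in> V - {z}" "w' \<in> V - {z}" "E w w'"
    show "w' \<in> ?T \<union> ?S"
    proof (cases "E z w'")
      case nbr: True
      show ?thesis
      proof (cases "w \<in> ?T")
        case True
        then show ?thesis
          using close[of w w'] w nbr by blast
      next
        case False
        then obtain v w0 where v: "v \<in> ?T" "w0 \<in> ?W" "w \<in> ?W" "E v w0" "connected_in E ?W w0 w"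
          using w(1) by blast
        have "v = w' \<or> E v w'"
        proof (rule ccontr)
          assume "\<not> (v = w' \<or> E v w')"
          then show False
            using no_detour[of z v w' ?W w0 w] V w nbr v by blast
        qed
        then show ?thesis
          using v(1) close[of v w'] w(3) nbr by blast
      qed
    next
      case False
      then have w': "w' \<in> ?W" using w by blast
      show ?thesis
      proof (cases "w \<in> ?T")
        case True
        with w' w(4) show ?thesis
          using connected_in_refl[of E ?W w'] by blast
      next
        case False
        then obtain v w0 where v: "v \<in> ?T" "w0 \<in> ?W" "w \<in> ?W" "E v w0" "connected_in E ?W w0 w"
          using w(1) by blast
        from connected_in_step[of E ?W, OF v(5) v(3) w' w(4)] show ?thesis
          using v w' by blast
      qed
    qed
  qed
  then show False
    using assms(6-8) E_sym by blast
qed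

text \<open>
  A smallest component \<open>C\<close> of any \<open>V - {y}\<close> is a leaf: either a single vertex, or a clique
  of twins that are all adjacent to \<open>y\<close>.
\<close>
lemma diamond_free_prunable:
  assumes df: "diamond_free V E" and "card V \<ge> 2"
  shows "\<exists>x v. prunable V E x v"
proof -
  \<comment> \<open>\<open>comp y u\<close> is the component of \<open>u\<close> after deletion of
    \<open>y\<close>; the pair is then chosen to make it smallest.\<close>
  define comp where "comp = (\<lambda>y u. {w. connected_in E (V - {y}) u w})"
  obtain y0 u0 where "y0 \<in> V" "u0 \<in> V" "u0 \<noteq> y0"
    using assms(2) card_le_Suc0_iff_eq[OF finite_V] by fastforce
  then have "fst (y0, u0) \<in> V \<and> snd (y0, u0) \<in> V \<and> snd (y0, u0) \<noteq> fst (y0, u0)"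
    by simp
  from ex_has_least_nat[where P = "\<lambda>p. fst p \<in> V \<and> snd p \<in> V \<and> snd p \<noteq> fst p"
      and m = "\<lambda>p. card (comp (fst p) (snd p))", OF this]
  obtain p where p: "fst p \<in> V" "snd p \<in> V" "snd p \<noteq> fst p"
    "\<And>q. fst q \<in> V \<and> snd q \<in> V \<and> snd q \<noteq> fst q \<Longrightarrow> card (comp (fst p) (snd p)) \<le> card (comp (fst q) (snd q))"
    by blast
  obtain y u where "p = (y, u)" by (cases p)
  with p have yu: "y \<in> V" "u \<in> V" "u \<noteq> y"
    and least: "\<And>y' u'. y' \<in> V \<Longrightarrow> u' \<in> V \<Longrightarrow> u' \<noteq> y' \<Longrightarrow> card (comp y u) \<le> card (comp y' u')"
    by auto
  let ?C = "comp y u"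
  have C_sub: "?C \<subseteq> V - {y}"
    using connected_in_subset[of E "V - {y}" u] yu by (auto simp: comp_def)
  then have fin: "finite ?C"
    using finite_V finite_subset by blast
  have u: "u \<in> ?C"
    by (simp add: comp_def)
  have C_closed: "w' \<in> ?C" if "w \<in> ?C" "E w w'" "w' \<in> V" "w' \<noteq> y" for w w'
    using that C_sub connected_in_step[of E "V - {y}" u w w'] by (auto simp: comp_def)
  have no_smaller: False if "z \<in> ?C" "w \<in> ?C" "w \<noteq> z" "comp z w \<subseteq> ?C" for z w
  proof -
    have "z \<notin> comp z w"
      using connected_in_subset[of E "V - {z}" w z] that C_sub by (auto simp: comp_def)
    then have "comp z w \<subset> ?C"
      using that by blast
    then have "card (comp z w) < card ?C"
      using fin psubset_card_mono by blast
    then show False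
      using least[of z w] that C_sub by fastforce
  qed
  \<comment> \<open>The first case gives a vertex with no neighbour but \<open>y\<close>, the last a
    pair of twins. The two in between contradict minimality.\<close>
  consider "?C = {u}" | z where "z \<in> ?C" "z \<noteq> u" "\<forall>w\<in>?C. \<not> E w y"
    | w w' where "w \<in> ?C" "\<not> E w y" "w' \<in> ?C" "E w' y"
    | z where "z \<in> ?C" "z \<noteq> u" "\<forall>w\<in>?C. E w y"
    using u by blast
  then show ?thesis
  proof cases
    case 1
    then have "\<forall>w\<in>V. E u w \<longrightarrow> w = y"
      using C_closed[OF u] E_irrefl by (metis singletonD)
    then show ?thesis
      using yu unfolding prunable_def by blast
  next
    case (2 z)
    have "comp z u \<subseteq> ?C"
    proof
      fix w assume "w \<in> comp z u"
      then have "connected_in E (V - {z}) u w"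
        by (simp add: comp_def)
      then show "w \<in> ?C"
        by (rule connected_in_closed) (use u C_closed 2 in blast)+
    qed
    then show ?thesis
      using no_smaller[of z u] 2 u by blast
  next
    case (3 a b)
    \<comment> \<open>As \<open>?C\<close> is connected, some edge in it joins a neighbour
      \<open>p\<close> of \<open>y\<close> to a non-neighbour \<open>q\<close>. Then
      \<open>p\<close> separates \<open>q\<close> from \<open>y\<close>, so the component of
      \<open>q\<close> after deleting \<open>p\<close> stays inside \<open>?C\<close> and lacks
      \<open>p\<close>.\<close>
    have "\<exists>p\<in>?C. \<exists>q\<in>?C. E p q \<and> E p y \<and> \<not> E q y"
    proof (rule ccontr)
      assume none: "\<not> ?thesis"
      have stays: "E w y = E u y" if "connected_in E (V - {y}) u w" for w
        using that unfolding connected_in_def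
      proof (induction rule: rtranclp_induct)
        case (step p q)
        then have "p \<in> ?C" "q \<in> ?C"
          unfolding comp_def connected_in_def by (auto intro: rtranclp.rtrancl_into_rtrancl)
        then show ?case
          using none step E_sym by blast
      qed simp
      from stays[of a] stays[of b] have "E a y = E b y"
        using 3(1,3) unfolding comp_def by blast
      then show False using 3 by blast
    qed
    then obtain p q where pq: "p \<in> ?C" "q \<in> ?C" "E p q" "E p y" "\<not> E q y"
      by blast
    have V: "p \<in> V" "q \<in> V" "q \<noteq> y" "p \<noteq> y" "q \<noteq> p"
      using pq C_sub E_irrefl by auto
    have y_out: "\<not> connected_in E (V - {p}) q y"
      using diamond_free_cut_vertex[OF df, of p q y] V yu pq by blast
    have "comp p q \<subseteq> ?C"
    proof
      fix w assume "w \<in> comp p q"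
      then have "connected_in E (V - {p}) q w"
        by (simp add: comp_def)
      then have "w \<in> {w \<in> ?C. connected_in E (V - {p}) q w}"
      proof (rule connected_in_closed)
        show "q \<in> {w \<in> ?C. connected_in E (V - {p}) q w}"
          using pq by simp
        fix s t assume st: "s \<in> {w \<in> ?C. connected_in E (V - {p}) q w}" "s \<in> V - {p}" "t \<in> V - {p}" "E s t"
        then have "connected_in E (V - {p}) q t"
          using connected_in_step[of E "V - {p}" q s t] by blast
        moreover from this have "t \<noteq> y" using y_out by blast
        ultimately show "t \<in> {w \<in> ?C. connected_in E (V - {p}) q w}"
          using C_closed[of s t] st by blast
      qed
      then show "w \<in> ?C" by blast
    qed
    then show ?thesis
      using no_smaller[of p q] pq V by blast
  next
    case (4 z)
    \<comment> \<open>An induced path from \<open>u\<close> through \<open>s\<close> to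
      \<open>t\<close> inside \<open>?C\<close> would form a diamond with \<open>y\<close>.\<close>
    have adj_u: "w = u \<or> E w u" if "w \<in> ?C" for w
    proof -
      have "connected_in E (V - {y}) u w"
        using that by (simp add: comp_def)
      then have "w \<in> {w \<in> ?C. w = u \<or> E w u}"
      proof (rule connected_in_closed)
        show "u \<in> {w \<in> ?C. w = u \<or> E w u}"
          using u by simp
        fix s t assume st: "s \<in> {w \<in> ?C. w = u \<or> E w u}" "s \<in> V - {y}" "t \<in> V - {y}" "E s t"
        have t: "t \<in> ?C" using C_closed[of s t] st by blast
        have "t = u \<or> E t u"
        proof (rule ccontr)
          assume "\<not> (t = u \<or> E t u)"
          then have "diamond E y s u t"
            using st t 4(3) u E_sym unfolding diamond_def by blast
          then show False
            using diamond_freeD[OF df] st yu by blast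
        qed
        with t show "t \<in> {w \<in> ?C. w = u \<or> E w u}" by blast
      qed
      then show ?thesis by blast
    qed
    have zu: "E z u" using adj_u 4 by blast
    have z: "z \<in> V" using 4 C_sub by blast
    \<comment> \<open>Stated for the unordered pair of \<open>u\<close> and \<open>z\<close>, so
      that it yields both inclusions needed for twins.\<close>
    have half: "E b w" if "w \<in> V - {u, z}" "E a w" "{a, b} = {u, z}" for a b w
    proof (cases "w = y")
      case True
      then show ?thesis using that(3) 4 u by (metis insertCI doubleton_eq_iff)
    next
      case False
      have ab: "a \<in> ?C" "b \<in> ?C" "E a b" "a \<in> V" "b \<in> V"
        using that(3) 4 u zu z yu E_sym by (auto simp: doubleton_eq_iff)
      then have "w \<in> ?C"
        using C_closed[of a w] that False by blast
      then have "\<not> diamond E y a b w"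
        using diamond_freeD[OF df] that yu ab by blast
      moreover have "E y a" "E y b" "E y w" "b \<noteq> w"
        using 4(3) ab E_sym \<open>w \<in> ?C\<close> that by blast+
      ultimately show ?thesis
        using ab that(2) unfolding diamond_def by blast
    qed
    have "\<forall>w\<in>V - {u, z}. E u w = E z w"
      using half[of _ u z] half[of _ z u] by blast
    then show ?thesis
      using yu z 4(2) unfolding prunable_def by blast
  qed
qed

lemma diamond_free_layout_width:
  assumes "diamond_free V E"
  shows "layout_width_le 2 V E"
proof (rule layout_width_le_prune[OF finite_V E_sym])
  fix W assume W: "W \<subseteq> V" "card W \<ge> 2"
  interpret W: chordal_adj W E
    by (rule chordal_adj_subset[OF W(1)])
  show "\<exists>x v. prunable W E x v"
    using W.diamond_free_prunable diamond_free_subset[OF assms] W by blast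
qed

end

section \<open>Widths of special graphs\<close>

text \<open>Without the edges inside \<open>X\<close> and inside \<open>N\<close> a bipartite chain
  graph remains. A vertex of \<open>X\<close> with fewest neighbours has at most one, and is
  prunable itself, or has two, which by minimality are adjacent to all of \<open>X\<close> and hence
  twins. The flip with two classes gives \<open>2 * 2 + 1\<close>.\<close>

lemma chain_layout_width:
  assumes "finite X" "finite N" "X \<inter> N = {}" and sym: "\<And>x y. E x y \<Longrightarrow> E y x"
    and clique: "\<And>x y. x \<in> X \<Longrightarrow> y \<in> X \<Longrightarrow> x \<noteq> y \<Longrightarrow> E x y"
      "\<And>x y. x \<in> N \<Longrightarrow> y \<in> N \<Longrightarrow> x \<noteq> y \<Longrightarrow> E x y"
    and nested: "\<And>p q. p \<in> X \<Longrightarrow> q \<in> X \<Longrightarrow>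
      {m \<in> N. E p m} \<subseteq> {m \<in> N. E q m} \<or> {m \<in> N. E q m} \<subseteq> {m \<in> N. E p m}"
  shows "layout_width_le 5 (X \<union> N) E"
proof -
  let ?E = "\<lambda>x y. E x y \<and> (x \<in> X) \<noteq> (y \<in> X)"
  have "layout_width_le 2 (X \<union> N) ?E"
  proof (rule layout_width_le_prune)
    fix W assume W: "W \<subseteq> X \<union> N" "card W \<ge> 2"
    then have "finite W" using finite_subset[OF W(1)] assms(1,2) by simp
    have other: "\<exists>v\<in>W. v \<noteq> x" for x
    proof (rule ccontr)
      assume "\<not> (\<exists>v\<in>W. v \<noteq> x)"
      then have "W \<subseteq> {x}" by blast
      then show False
        using W(2) card_mono[of "{x}" W] by simp
    qed
    show "\<exists>x v. prunable W ?E x v"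
    proof (cases "W \<inter> X = {}")
      case True
      obtain x where "x \<in> W" using other by blast
      then show ?thesis
        using other[of x] True unfolding prunable_def by blast
    next
      case False
      let ?A = "\<lambda>p. {m \<in> N \<inter> W. E p m}"
      from False obtain p0 where "p0 \<in> W \<inter> X" by blast
      from ex_has_least_nat[where P = "\<lambda>p. p \<in> W \<inter> X" and m = "\<lambda>p. card (?A p)", OF this]
      obtain p where p: "p \<in> W" "p \<in> X" and least: "\<And>q. q \<in> W \<inter> X \<Longrightarrow> card (?A p) \<le> card (?A q)"
        by blast
      have min: "?A p \<subseteq> ?A q" if "q \<in> W \<inter> X" for q
      proof -
        have "?A p \<subseteq> ?A q \<or> ?A q \<subseteq> ?A p"
          using nested[of p q] p that by blast
        then show ?thesis
          using least[OF that] card_seteq[of "?A p" "?A q"] \<open>finite W\<close> by auto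
      qed
      show ?thesis
      proof (cases "\<exists>m m'. m \<in> ?A p \<and> m' \<in> ?A p \<and> m \<noteq> m'")
        case True
        then obtain m m' where m: "m \<in> ?A p" "m' \<in> ?A p" "m \<noteq> m'" by blast
        have "?E m y = ?E m' y" if "y \<in> W" for y
        proof (cases "y \<in> X")
          case True
          then have "m \<in> ?A y" "m' \<in> ?A y"
            using min[of y] m that by auto
          then show ?thesis
            using sym assms(3) True by blast
        next
          case False
          then show ?thesis using m assms(3) by blast
        qed
        then show ?thesis
          using m unfolding prunable_def by blast
      next
        case False
        have nbr: "y \<in> ?A p" if "?E p y" "y \<in> W" for y
          using that p W by blast
        obtain v where "v \<in> W" "v \<noteq> p" "\<forall>y\<in>W. ?E p y \<longrightarrow> y = v"
        proof (cases "?A p = {}")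
          case True
          then show ?thesis using that other[of p] nbr by blast
        next
          case ne: False
          then obtain v where "v \<in> ?A p" by blast
          then show ?thesis
            using that[of v] False nbr p assms(3) by blast
        qed
        then show ?thesis
          using p unfolding prunable_def by blast
      qed
    qed
  qed (use assms(1,2) sym in auto)
  then have "layout_width_le (2 * 2 + 1) (X \<union> N) E"
  proof (rule layout_width_le_flip[where f = "\<lambda>x. x \<in> X" and D = "(=)"])
    have "card ((\<lambda>x. x \<in> X) ` (X \<union> N)) \<le> card (UNIV :: bool set)"
      by (rule card_mono) auto
    then show "card ((\<lambda>x. x \<in> X) ` (X \<union> N)) \<le> 2"
      by simp
    show "?E x y = (E x y \<noteq> ((x \<in> X) = (y \<in> X)))" if "x \<in> X \<union> N" "y \<in> X \<union> N" "x \<noteq> y" for x y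
      using that clique by blast
  qed (use assms(1,2) in simp)
  then show ?thesis by simp
qed

definition dominating_diamonds :: "'a set \<Rightarrow> ('a \<Rightarrow> 'a \<Rightarrow> bool) \<Rightarrow> bool" where
  "dominating_diamonds V E \<longleftrightarrow> (\<forall>a\<in>V. \<forall>b\<in>V. \<forall>c\<in>V. \<forall>d\<in>V. \<forall>r\<in>V.
     diamond E a b c d \<longrightarrow> E r a \<or> E r b \<or> E r c \<or> E r d)"

lemma dominating_diamondsD:
  "dominating_diamonds V E \<Longrightarrow> diamond E a b c d \<Longrightarrow> {a, b, c, d, r} \<subseteq> V \<Longrightarrow>
    E r a \<or> E r b \<or> E r c \<or> E r d"
  unfolding dominating_diamonds_def by blast

lemma dominating_diamonds_subset:
  "dominating_diamonds V E \<Longrightarrow> W \<subseteq> V \<Longrightarrow> dominating_diamonds W E"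
  unfolding dominating_diamonds_def by blast

section \<open>A clique to which the rest attaches almost uniformly\<close>

context chordal_adj
begin

text \<open>The value \<open>\<kappa> x\<close> names the only vertex of \<open>N\<close> at which
  \<open>x\<close> may deviate from the pattern \<open>D\<close>. After flipping by the pattern and
  removing the edges in \<open>N\<close>, each fibre of \<open>?\<phi>\<close> holds at most one
  vertex of \<open>N\<close>, and deleting it leaves a diamond-free graph, so the fibre has width 4.
  Flipping back has twice as many classes as there are values of \<open>f\<close>.\<close>

lemma coloured_layout_width:
  fixes f :: "'a \<Rightarrow> 'c::finite" and \<kappa> :: "'a \<Rightarrow> 'a option"
  assumes "N \<subseteq> V" "diamond_free (V - N) E"
    and clique: "\<And>x y. x \<in> N \<Longrightarrow> y \<in> N \<Longrightarrow> x \<noteq> y \<Longrightarrow> E x y"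
    and const: "\<And>x y. x \<in> V - N \<Longrightarrow> y \<in> V - N \<Longrightarrow> E x y \<Longrightarrow> \<kappa> x = \<kappa> y"
    and cross: "\<And>x m. x \<in> V - N \<Longrightarrow> m \<in> N \<Longrightarrow> E x m \<noteq> D (f x) (f m) \<Longrightarrow> \<kappa> x = Some m"
  shows "layout_width_le (8 * card (UNIV :: 'c set) + 1) V E"
proof -
  let ?E = "\<lambda>x y. if x \<in> N then (if y \<in> N then False else E x y \<noteq> D (f y) (f x))
    else if y \<in> N then E x y \<noteq> D (f x) (f y) else E x y"
  let ?\<phi> = "\<lambda>x. if x \<in> N then Some x else \<kappa> x"
  have "layout_width_le 4 V ?E"
  proof (rule layout_width_le_fibres[where \<phi> = ?\<phi>])
    show "?\<phi> x = ?\<phi> y" if "x \<in> V" "y \<in> V" "?E x y" for x y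
    proof -
      have "E x y = E y x" using E_sym by blast
      then show ?thesis
        using that const[of x y] cross[of x y] cross[of y x] by (auto split: if_splits)
    qed
    fix i
    let ?F = "{x \<in> V. ?\<phi> x = i}"
    \<comment> \<open>The option \<open>i\<close> itself names the vertex of \<open>N\<close> in its
      fibre; the fibre of \<open>None\<close> contains none.\<close>
    have sub: "?F - set_option i \<subseteq> V - N"
      by auto
    interpret F: chordal_adj "?F - set_option i" E
      by (rule chordal_adj_subset) auto
    have "layout_width_le 2 (?F - set_option i) E"
      using F.diamond_free_layout_width diamond_free_subset[OF assms(2) sub] by blast
    then have "layout_width_le 2 (?F - set_option i) ?E"
      by (rule layout_width_le_cong) (use sub in auto)
    then have "layout_width_le (2 * 2 ^ 1) ?F ?E"
      by (rule layout_width_le_delete) (cases i; simp)+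
    then show "layout_width_le 4 ?F ?E" by simp
  qed (use finite_V in auto)
  then have "layout_width_le (2 * card (UNIV :: 'c set) * 4 + 1) V E"
  proof (rule layout_width_le_flip[where f = "\<lambda>x. (x \<in> N, f x)" and
        D = "\<lambda>(a, c) (b, d). if a then (if b then True else D d c) else if b then D c d else False"])
    have "card ((\<lambda>x. (x \<in> N, f x)) ` V) \<le> card (UNIV :: (bool \<times> 'c) set)"
      by (rule card_mono) auto
    then show "card ((\<lambda>x. (x \<in> N, f x)) ` V) \<le> 2 * card (UNIV :: 'c set)"
      by (simp add: card_cartesian_product flip: UNIV_Times_UNIV)
  qed (use clique finite_V in auto)
  then show ?thesis by (simp add: algebra_simps)
qed

text \<open>If \<open>x\<close> and \<open>y\<close> were adjacent, then \<open>x\<close>,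
  \<open>m'\<close>, \<open>m\<close>, \<open>y\<close> would be an induced
  \<open>C_4\<close>.\<close>

lemma differently_coloured_nonadjacent:
  assumes "M \<subseteq> V" and clique: "\<And>x y. x \<in> M \<Longrightarrow> y \<in> M \<Longrightarrow> x \<noteq> y \<Longrightarrow> E x y"
    and miss: "\<And>x m m'. x \<in> V - M \<Longrightarrow> m \<in> M \<Longrightarrow> m' \<in> M \<Longrightarrow> \<not> E x m \<Longrightarrow> \<not> E x m' \<Longrightarrow> m = m'"
    and "x \<in> V - M" "y \<in> V - M" "m \<in> M" "m' \<in> M" "m \<noteq> m'" "\<not> E x m" "\<not> E y m'"
  shows "\<not> E x y \<and> x \<noteq> y"
proof -
  have "E x m'" "E y m"
    using miss[of x m m'] miss[of y m m'] assms(4-) by blast+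
  then show ?thesis
    using no_C4[of x y m m'] assms(1,4-) clique[of m m'] E_sym by blast
qed

text \<open>
  Think of \<open>x\<close> as coloured \<open>m\<close> when it misses \<open>m\<close>. An uncoloured vertex inherits the colour of its
  coloured neighbours; this relation \<open>R\<close> is closed under adjacency because an induced path
  \<open>r x y\<close> together with a vertex of \<open>M\<close> forms a diamond, which all vertices of the other colours
  have to meet.
\<close>
lemma near_complete_no_bicoloured:
  assumes "M \<subseteq> V" and clique: "\<And>x y. x \<in> M \<Longrightarrow> y \<in> M \<Longrightarrow> x \<noteq> y \<Longrightarrow> E x y"
    and miss: "\<And>x m m'. x \<in> V - M \<Longrightarrow> m \<in> M \<Longrightarrow> m' \<in> M \<Longrightarrow> \<not> E x m \<Longrightarrow> \<not> E x m' \<Longrightarrow> m = m'"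
    and dom: "dominating_diamonds V E" and df: "diamond_free (V - M) E"
    and three: "card {m \<in> M. \<exists>r\<in>V - M. \<not> E r m} \<ge> 3"
    and nobi: "\<And>f r r' m m'. f \<in> V - M \<Longrightarrow> \<forall>m\<in>M. E f m \<Longrightarrow> r \<in> V - M \<Longrightarrow> r' \<in> V - M \<Longrightarrow>
      m \<in> M \<Longrightarrow> m' \<in> M \<Longrightarrow> \<not> E r m \<Longrightarrow> \<not> E r' m' \<Longrightarrow> E f r \<Longrightarrow> E f r' \<Longrightarrow> m = m'"
  shows "layout_width_le 9 V E"
proof -
  let ?C = "{m \<in> M. \<exists>r\<in>V - M. \<not> E r m}"
  have two_others: "\<exists>a\<in>?C. \<exists>b\<in>?C. a \<noteq> b \<and> a \<noteq> m \<and> b \<noteq> m" for m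
  proof (rule ccontr)
    assume none: "\<not> ?thesis"
    have "finite (?C - {m})"
      using finite_subset[OF assms(1) finite_V] by simp
    then have "card (?C - {m}) \<le> Suc 0"
      using none by (subst card_le_Suc0_iff_eq) blast+
    then show False
      using three card_Diff1_le[of ?C m] by (simp add: card_Diff_singleton_if split: if_splits)
  qed
  have diff: "\<not> E x y \<and> x \<noteq> y" if "x \<in> V - M" "y \<in> V - M" "m \<in> M" "m' \<in> M" "m \<noteq> m'" "\<not> E x m" "\<not> E y m'"
    for x y m m'
    by (rule differently_coloured_nonadjacent[OF assms(1) _ _ that]) (use clique miss in blast)+
  define R where "R = (\<lambda>x m. m \<in> M \<and> (\<not> E x m \<or> (\<forall>m'\<in>M. E x m') \<and> (\<exists>r\<in>V - M. E x r \<and> \<not> E r m)))"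
  have R_unique: "m = m'" if "x \<in> V - M" "R x m" "R x m'" for x m m'
    using that miss[of x m m'] nobi[of x] unfolding R_def by metis
  have R_step: "R y m" if x: "x \<in> V - M" and y: "y \<in> V - M" and xy: "E x y" and m: "R x m" for x y m
  proof (cases "\<not> E x m")
    case True
    show ?thesis
    proof (cases "\<forall>m'\<in>M. E y m'")
      case True
      then show ?thesis
        using \<open>\<not> E x m\<close> x xy m E_sym unfolding R_def by blast
    next
      case False
      then show ?thesis
        using diff[of x y m] True x y xy m unfolding R_def by blast
    qed
  next
    case False
    then obtain r where full: "\<forall>m'\<in>M. E x m'" and r: "r \<in> V - M" "E x r" "\<not> E r m" and mM: "m \<in> M"
      using m unfolding R_def by blast
    show ?thesis
    proof (cases "\<forall>m'\<in>M. E y m'")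
      case y_full: True
      \<comment> \<open>Otherwise \<open>r\<close> and \<open>y\<close> are the tips of a diamond
        with \<open>x\<close> and any further colour \<open>a\<close>. A vertex missing
        \<open>a\<close> can meet it only in \<open>y\<close>, so the two further colours both
        appear next to the uncoloured \<open>y\<close>. This is where three colours enter.\<close>
      have "E y r"
      proof (rule ccontr)
        assume "\<not> E y r"
        have nbr: "E y s" if a: "a \<in> M" "a \<noteq> m" and s: "s \<in> V - M" "\<not> E s a" for a s
        proof -
          have "E r a"
            using miss[of r m a] r mM a by blast
          then have "diamond E a x r y"
            using a full r y_full xy \<open>\<not> E y r\<close> mM E_sym unfolding diamond_def by blast
          then have "E s a \<or> E s x \<or> E s r \<or> E s y"
            using dominating_diamondsD[OF dom] a assms(1) x y r s by blast
          moreover have "\<not> E s x"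
            using nobi[OF x full r(1) s(1) mM a(1) r(3) s(2) r(2)] a E_sym by blast
          moreover have "\<not> E s r"
            using diff[of s r a m] s r a mM by blast
          ultimately show ?thesis
            using s E_sym by blast
        qed
        obtain a b s t where "a \<in> M" "b \<in> M" "a \<noteq> b" "a \<noteq> m" "b \<noteq> m" "s \<in> V - M" "t \<in> V - M"
          "\<not> E s a" "\<not> E t b"
          using two_others[of m] by blast
        then show False
          using nbr[of a s] nbr[of b t] nobi[OF y y_full, of s t a b] by blast
      qed
      then show ?thesis
        using r mM y_full unfolding R_def by blast
    next
      case False
      then obtain m' where m': "m' \<in> M" "\<not> E y m'" by blast
      \<comment> \<open>The coloured vertices \<open>r\<close> and \<open>y\<close> are both
        neighbours of the uncoloured \<open>x\<close>, so their colours agree.\<close>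
      then have "m = m'"
        using nobi[OF x full r(1) y mM _ r(3) _ r(2) xy] by blast
      with m' show ?thesis unfolding R_def by blast
    qed
  qed
  define \<kappa> where "\<kappa> x = (if \<exists>m. R x m then Some (SOME m. R x m) else None)" for x
  have "layout_width_le (8 * card (UNIV :: unit set) + 1) V E"
  proof (rule coloured_layout_width[where \<kappa> = \<kappa> and D = "\<lambda>_ _. True" and f = "\<lambda>_. ()"])
    fix x y assume xy: "x \<in> V - M" "y \<in> V - M" "E x y"
    then have "R x = R y"
      using R_step[of x y] R_step[of y x] E_sym by blast
    then show "\<kappa> x = \<kappa> y"
      unfolding \<kappa>_def by simp
  next
    fix x m assume "x \<in> V - M" "m \<in> M" "E x m \<noteq> True"
    then have "R x m" unfolding R_def by blast
    then show "\<kappa> x = Some m"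
      using R_unique[OF \<open>x \<in> V - M\<close>] unfolding \<kappa>_def by (auto intro: some_equality)
  qed (use assms(1) clique df in auto)
  then show ?thesis by simp
qed

text \<open>Call a vertex of \<open>M\<close> a colour if some vertex outside \<open>M\<close>
  misses it. Deleting at most two colours makes the rest of \<open>M\<close> complete to
  \<open>V - M\<close>, with bound \<open>9 * 2 ^ 2\<close>. With three or more, a vertex
  \<open>f\<close> complete to \<open>M\<close> that sees two colours sees all coloured vertices,
  and its deletion leaves no other vertex of this kind.\<close>

lemma near_complete_layout_width:
  assumes "M \<subseteq> V" and clique: "\<And>x y. x \<in> M \<Longrightarrow> y \<in> M \<Longrightarrow> x \<noteq> y \<Longrightarrow> E x y"
    and miss: "\<And>x m m'. x \<in> V - M \<Longrightarrow> m \<in> M \<Longrightarrow> m' \<in> M \<Longrightarrow> \<not> E x m \<Longrightarrow> \<not> E x m' \<Longrightarrow> m = m'"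
    and dom: "dominating_diamonds V E" and df: "diamond_free (V - M) E"
  shows "layout_width_le 36 V E"
proof -
  let ?C = "{m \<in> M. \<exists>r\<in>V - M. \<not> E r m}"
  have fin: "finite ?C"
    using finite_subset[OF assms(1) finite_V] by simp
  have diff: "\<not> E x y \<and> x \<noteq> y" if "x \<in> V - M" "y \<in> V - M" "m \<in> M" "m' \<in> M" "m \<noteq> m'" "\<not> E x m" "\<not> E y m'"
    for x y m m'
    by (rule differently_coloured_nonadjacent[OF assms(1) _ _ that]) (use clique miss in blast)+
  show ?thesis
  proof (cases "card ?C \<ge> 3")
    case False
    interpret W: chordal_adj "V - ?C" E
      by (rule chordal_adj_subset) blast
    have VM: "V - ?C - (M - ?C) = V - M"
      by blast
    have "layout_width_le (8 * card (UNIV :: unit set) + 1) (V - ?C) E"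
    proof (rule W.coloured_layout_width[where N = "M - ?C" and \<kappa> = "\<lambda>_. None" and D = "\<lambda>_ _. True"
          and f = "\<lambda>_. ()"])
      show "diamond_free (V - ?C - (M - ?C)) E"
        unfolding VM by (rule df)
    qed (use assms(1) clique in auto)
    then have "layout_width_le (9 * 2 ^ 2) V E"
      using False fin by (intro layout_width_le_delete[where Z = ?C]) auto
    then show ?thesis by simp
  next
    case three: True
    show ?thesis
    proof (cases "\<exists>f r r' m m'. f \<in> V - M \<and> (\<forall>m\<in>M. E f m) \<and> r \<in> V - M \<and> r' \<in> V - M \<and>
        m \<in> M \<and> m' \<in> M \<and> \<not> E r m \<and> \<not> E r' m' \<and> E f r \<and> E f r' \<and> m \<noteq> m'")
      case False
      have "layout_width_le 9 V E"
        by (rule near_complete_no_bicoloured[OF assms(1) _ _ dom df three]) (use False clique miss in blast)+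
      then show ?thesis
        by (rule layout_width_le_mono) simp
    next
      case True
      then obtain f r1 r2 m1 m2 where f: "f \<in> V - M" and f_full: "\<forall>m\<in>M. E f m"
        and r: "r1 \<in> V - M" "r2 \<in> V - M" "m1 \<in> M" "m2 \<in> M" "\<not> E r1 m1" "\<not> E r2 m2" "E f r1" "E f r2" "m1 \<noteq> m2"
        by blast
      \<comment> \<open>The diamond with \<open>a\<close>, \<open>f\<close> in the middle and tips
        \<open>u\<close>, \<open>v\<close> must be met by \<open>s\<close>, which is adjacent to
        none of \<open>a\<close>, \<open>u\<close>, \<open>v\<close>.\<close>
      have third: "E f s" if "s \<in> V - M" "a \<in> M" "\<not> E s a" "u \<in> V - M" "v \<in> V - M" "b \<in> M" "c \<in> M"
        "\<not> E u b" "\<not> E v c" "E f u" "E f v" "a \<noteq> b" "a \<noteq> c" "b \<noteq> c" for s a u v b c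
      proof -
        have "E u a" "E v a"
          using miss[of u a b] miss[of v a c] that by blast+
        moreover have "\<not> E u v \<and> u \<noteq> v" "\<not> E s u \<and> s \<noteq> u" "\<not> E s v \<and> s \<noteq> v"
          using diff[of u v b c] diff[of s u a b] diff[of s v a c] that by blast+
        ultimately have "diamond E a f u v"
          using f_full that E_sym unfolding diamond_def by blast
        then have "E s a \<or> E s f \<or> E s u \<or> E s v"
          using dominating_diamondsD[OF dom] that f assms(1) by blast
        then show ?thesis
          using that \<open>\<not> E s u \<and> s \<noteq> u\<close> \<open>\<not> E s v \<and> s \<noteq> v\<close> E_sym by blast
      qed
      obtain m3 r3 where m3: "m3 \<in> M" "r3 \<in> V - M" "\<not> E r3 m3" "m3 \<noteq> m1" "m3 \<noteq> m2"
      proof -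
        have "\<not> ?C \<subseteq> {m1, m2}"
        proof
          assume "?C \<subseteq> {m1, m2}"
          then have "card ?C \<le> card {m1, m2}"
            by (rule card_mono[rotated]) simp
          then show False
            using three r(9) by simp
        qed
        then show ?thesis using that by blast
      qed
      have f3: "E f r3"
        using third[of r3 m3 r1 r2 m1 m2] r m3 by blast
      \<comment> \<open>At least two of the three colours \<open>m1\<close>, \<open>m2\<close>,
        \<open>m3\<close> differ from \<open>a\<close>, as \<open>third\<close> demands.\<close>
      have f_all: "E f s" if "s \<in> V - M" "a \<in> M" "\<not> E s a" for s a
      proof -
        consider "a = m1" | "a = m2" | "a \<noteq> m1" "a \<noteq> m2" by blast
        then show ?thesis
        proof cases
          case 1
          then show ?thesis using third[of s a r2 r3 m2 m3] that r m3 f3 by blast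
        next
          case 2
          then show ?thesis using third[of s a r1 r3 m1 m3] that r m3 f3 by blast
        next
          case 3
          then show ?thesis using third[of s a r1 r2 m1 m2] that r by blast
        qed
      qed
      let ?V = "V - {f}"
      interpret W: chordal_adj ?V E
        by (rule chordal_adj_subset) blast
      have "layout_width_le 9 ?V E"
      proof (rule W.near_complete_no_bicoloured[of M])
        show "M \<subseteq> ?V" using assms(1) f by blast
        show "dominating_diamonds ?V E"
          by (rule dominating_diamonds_subset[OF dom]) blast
        show "diamond_free (?V - M) E"
          by (rule diamond_free_subset[OF df]) blast
        have "{m \<in> M. \<exists>r\<in>?V - M. \<not> E r m} = ?C"
          using f_full by blast
        then show "card {m \<in> M. \<exists>r\<in>?V - M. \<not> E r m} \<ge> 3"
          using three by simp
      next
        fix g s s' a a'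
        assume g: "g \<in> ?V - M" "\<forall>m\<in>M. E g m" "s \<in> ?V - M" "s' \<in> ?V - M" "a \<in> M" "a' \<in> M"
          "\<not> E s a" "\<not> E s' a'" "E g s" "E g s'"
        show "a = a'"
        proof (rule ccontr)
          assume "a \<noteq> a'"
          then have ss: "\<not> E s s' \<and> s \<noteq> s'"
            using diff[of s s' a a'] g by blast
          have fs: "E f s" "E f s'"
            using f_all g by blast+
          \<comment> \<open>The vertices \<open>f\<close> and \<open>g\<close> share the nonadjacent
            neighbours \<open>s\<close>, \<open>s'\<close>: nonadjacent they would give a
            \<open>C_4\<close>, adjacent a diamond outside \<open>M\<close>.\<close>
          then have "E f g"
            using no_C4[of f s g s'] ss f g E_sym by blast
          then have "diamond E f g s s'"
            using fs ss g unfolding diamond_def by blast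
          then show False
            using diamond_freeD[OF df] f g by blast
        qed
      qed (use clique miss in blast)+
      then have "layout_width_le (2 * 9) V E"
        by (rule layout_width_le_delete1) simp
      then show ?thesis
        by (rule layout_width_le_mono) simp
    qed
  qed
qed

end

section \<open>An extremal nonadjacent pair\<close>

lemma subsingleton_card:
  assumes "\<And>x y. x \<in> S \<Longrightarrow> y \<in> S \<Longrightarrow> x = y"
  shows "finite S" "card S \<le> 1"
proof -
  have "S = {} \<or> (\<exists>a. S = {a})"
    using assms by blast
  then show "finite S" "card S \<le> 1"
    by auto
qed

text \<open>
  Up to four exceptional vertices \<open>Z\<close>, flipping along the neighbourhood \<open>A\<close> of a reference vertex
  \<open>p0\<close> leaves all vertices of a clique of \<open>P\<close> attached to at most one and the same vertex,
  recorded by \<open>\<kappa>\<close>. Relative to \<open>A\<close>, a clique loses at most one vertex (\<open>X\<close>) and gains at most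
  one (\<open>Y\<close>); if some clique does both, every other clique that loses a different vertex must gain
  the same one, so deleting its two vertices suffices.
\<close>
lemma clique_family_colouring:
  assumes sym: "\<And>x y. E x y \<Longrightarrow> E y x"
    and trans: "\<And>p q r. p \<in> P \<Longrightarrow> q \<in> P \<Longrightarrow> r \<in> P \<Longrightarrow> E p q \<Longrightarrow> E q r \<Longrightarrow> p \<noteq> r \<Longrightarrow> E p r"
    and nested: "\<And>p q m m'. p \<in> P \<Longrightarrow> q \<in> P \<Longrightarrow> E p q \<Longrightarrow> m \<in> M \<Longrightarrow> m' \<in> M \<Longrightarrow>
      E p m \<Longrightarrow> \<not> E q m \<Longrightarrow> E q m' \<Longrightarrow> E p m'"
    and near: "\<And>p q m m'. p \<in> P \<Longrightarrow> q \<in> P \<Longrightarrow> p \<noteq> q \<Longrightarrow> \<not> E p q \<Longrightarrow> m \<in> M \<Longrightarrow> m' \<in> M \<Longrightarrow>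
      E p m \<Longrightarrow> E p m' \<Longrightarrow> \<not> E q m \<Longrightarrow> \<not> E q m' \<Longrightarrow> m = m'"
    and two: "p0 \<in> P" "p1 \<in> P" "p0 \<noteq> p1" "\<not> E p0 p1"
  shows "\<exists>Z A (\<kappa> :: 'a \<Rightarrow> 'a option). finite Z \<and> card Z \<le> 4 \<and> (\<forall>p\<in>P. \<forall>q\<in>P. E p q \<longrightarrow> \<kappa> p = \<kappa> q) \<and>
    (\<forall>p\<in>P. \<forall>m\<in>M - Z. E p m \<noteq> (m \<in> A) \<longrightarrow> \<kappa> p = Some m)"
proof -
  \<comment> \<open>By transitivity \<open>P\<close> is a disjoint union of cliques, and
    \<open>K p\<close> is the one containing \<open>p\<close>.\<close>
  define K where "K p = {q \<in> P. q = p \<or> E p q}" for p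
  have K_eq: "K p = K q" if "p \<in> P" "q \<in> P" "E p q" for p q
    unfolding K_def using that trans sym by blast
  have K_adj: "a = b \<or> E a b" if "p \<in> P" "a \<in> K p" "b \<in> K p" for p a b
    using that trans sym unfolding K_def by blast
  have K_sep: "a \<noteq> b \<and> \<not> E a b" if "p \<in> P" "q \<in> P" "q \<notin> K p" "a \<in> K p" "b \<in> K q" for p q a b
  proof -
    have "K a = K p" "K b = K q"
      using that K_eq sym unfolding K_def by blast+
    moreover have "q \<in> K q" "a \<in> P" "b \<in> P"
      using that unfolding K_def by blast+
    ultimately show ?thesis
      using that(3) K_eq by blast
  qed
  \<comment> \<open>If \<open>q\<close> or \<open>q'\<close> deviates from \<open>r\<close> at both
    vertices, \<open>near\<close> identifies them. Otherwise each deviates at one of them, in the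
    same direction, and their neighbourhoods are incomparable, against
    \<open>nested\<close>.\<close>
  have unique: "m = m'"
    if p: "p \<in> P" and r: "r \<in> P" "r \<notin> K p" and q: "q \<in> K p" "q' \<in> K p" and m: "m \<in> M" "m' \<in> M"
      and dir: "E r m = E r m'" "E q m \<noteq> E r m" "E q' m' \<noteq> E r m'" for p r q q' m m'
  proof -
    have P: "q \<in> P" "q' \<in> P"
      using q unfolding K_def by blast+
    have sep: "r \<noteq> q" "r \<noteq> q'" "\<not> E r q" "\<not> E r q'" "\<not> E q r" "\<not> E q' r"
      using K_sep[OF p r, of q r] K_sep[OF p r, of q' r] r(1) q sym unfolding K_def by blast+
    show ?thesis
    proof (cases "E q m' = E r m' \<and> E q' m = E r m")
      case True
      then have "q \<noteq> q'" using dir by blast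
      then have "E q q'" "E q' q"
        using K_adj[OF p q] sym by blast+
      then show ?thesis
        using nested[of q q' m m'] nested[of q' q m m'] nested[of q q' m' m] nested[of q' q m' m]
          True dir P m by blast
    next
      case False
      then show ?thesis
        using near[of r q m m'] near[of q r m m'] near[of r q' m m'] near[of q' r m m'] sep dir P r m by blast
    qed
  qed
  let ?A = "{m \<in> M. E p0 m}"
  define X Y where "X p = {m \<in> M. E p0 m \<and> (\<exists>q\<in>K p. \<not> E q m)}"
    and "Y p = {m \<in> M. \<not> E p0 m \<and> (\<exists>q\<in>K p. E q m)}" for p
  have p0_sep: "p0 \<notin> K p" if "p \<in> P" "p \<notin> K p0" for p
    using that two(1) sym unfolding K_def by blast
  have X_unique: "m = m'" if "p \<in> P" "p \<notin> K p0" "m \<in> X p" "m' \<in> X p" for p m m'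
    using that unique[OF that(1) two(1) p0_sep[OF that(1,2)]] unfolding X_def by blast
  have Y_unique: "m = m'" if "p \<in> P" "p \<notin> K p0" "m \<in> Y p" "m' \<in> Y p" for p m m'
    using that unique[OF that(1) two(1) p0_sep[OF that(1,2)]] unfolding Y_def by blast
  \<comment> \<open>A member \<open>b\<close> of the clique that gains \<open>y\<close> is adjacent
    to \<open>x\<close> as well, while a member \<open>w\<close> of the other misses
    \<open>x\<close>; by \<open>near\<close> it cannot miss \<open>y\<close> too.\<close>
  have Y_transfer: "y \<in> Y q"
    if p: "p \<in> P" "q \<in> P" "q \<notin> K p" and x: "x \<in> X q" "x \<notin> X p" and y: "y \<in> Y p" for p q x y
  proof -
    obtain b where b: "b \<in> K p" "E b y" "y \<in> M" "\<not> E p0 y"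
      using y unfolding Y_def by blast
    obtain w where w: "w \<in> K q" "\<not> E w x" "x \<in> M" "E p0 x"
      using x(1) unfolding X_def by blast
    have "E b x"
      using x(2) w b unfolding X_def by blast
    moreover have "b \<noteq> w \<and> \<not> E b w" "b \<in> P" "w \<in> P"
      using K_sep[OF p b(1) w(1)] b w unfolding K_def by blast+
    ultimately have "E w y"
      using near[of b w x y] b w by blast
    then show ?thesis
      using b w unfolding Y_def by blast
  qed
  \<comment> \<open>The clique of \<open>p0\<close> contains the reference itself and is compared
    with \<open>p1\<close> instead. Where two of its members disagree, one deviates from
    \<open>p1\<close>, so deleting \<open>X1\<close> and \<open>Y1\<close> makes it uniform.\<close>
  define X1 Y1 where "X1 = {m \<in> M. E p1 m \<and> (\<exists>q\<in>K p0. \<not> E q m)}"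
    and "Y1 = {m \<in> M. \<not> E p1 m \<and> (\<exists>q\<in>K p0. E q m)}"
  have p1: "p1 \<notin> K p0"
    using two unfolding K_def by blast
  have "m = m'" if "m \<in> X1" "m' \<in> X1" for m m'
    using that unique[OF two(1,2) p1] unfolding X1_def by blast
  note card_X1 = subsingleton_card[of X1, OF this]
  have "m = m'" if "m \<in> Y1" "m' \<in> Y1" for m m'
    using that unique[OF two(1,2) p1] unfolding Y1_def by blast
  note card_Y1 = subsingleton_card[of Y1, OF this]
  have "\<exists>Z2. finite Z2 \<and> card Z2 \<le> 2 \<and>
    (\<forall>p x y. p \<in> P \<longrightarrow> p \<notin> K p0 \<longrightarrow> x \<in> X p \<longrightarrow> y \<in> Y p \<longrightarrow> x \<in> Z2 \<or> y \<in> Z2)"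
  proof (cases "\<exists>p x y. p \<in> P \<and> p \<notin> K p0 \<and> x \<in> X p \<and> y \<in> Y p")
    case True
    then obtain s a b where s: "s \<in> P" "s \<notin> K p0" "a \<in> X s" "b \<in> Y s"
      by blast
    have "x \<in> {a, b} \<or> y \<in> {a, b}" if p: "p \<in> P" "p \<notin> K p0" "x \<in> X p" "y \<in> Y p" for p x y
    proof (cases "x \<in> X s")
      case True
      then show ?thesis
        using X_unique[OF s(1,2,3)] by blast
    next
      case False
      have "p \<notin> K s"
      proof
        assume "p \<in> K s"
        then have "K s = K p"
          using K_eq[of s p] s p unfolding K_def by blast
        then show False
          using False p(3) unfolding X_def by simp
      qed
      then have "b \<in> Y p"
        using Y_transfer[OF s(1) p(1) _ p(3) False s(4)] by blast
      then show ?thesis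
        using Y_unique[OF p(1,2,4)] by blast
    qed
    moreover have "card {a, b} \<le> 2"
      by (simp add: card_insert_if)
    ultimately show ?thesis
      by (intro exI[of _ "{a, b}"]) blast
  next
    case False
    then show ?thesis
      by (intro exI[of _ "{}"]) auto
  qed
  then obtain Z2 where Z2: "finite Z2" "card Z2 \<le> 2"
    and cut: "\<And>p x y. p \<in> P \<Longrightarrow> p \<notin> K p0 \<Longrightarrow> x \<in> X p \<Longrightarrow> y \<in> Y p \<Longrightarrow> x \<in> Z2 \<or> y \<in> Z2"
    by blast
  define Z where "Z = X1 \<union> Y1 \<union> Z2"
  \<comment> \<open>Outside \<open>Z\<close> a clique cannot both lose and gain a vertex, so at most
    one \<open>m\<close> qualifies.\<close>
  define colour where "colour p m \<longleftrightarrow> p \<notin> K p0 \<and> m \<in> (X p \<union> Y p) - Z" for p m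
  define \<kappa> where "\<kappa> p = (if \<exists>m. colour p m then Some (SOME m. colour p m) else None)" for p
  have "finite Z"
    unfolding Z_def using card_X1 card_Y1 Z2 by simp
  moreover have "card Z \<le> 4"
    unfolding Z_def using card_X1 card_Y1 Z2 card_Un_le[of "X1 \<union> Y1" Z2] card_Un_le[of X1 Y1] by linarith
  moreover have "\<kappa> p = \<kappa> q" if "p \<in> P" "q \<in> P" "E p q" for p q
  proof -
    have "K p = K q"
      by (rule K_eq[OF that])
    moreover have "p \<in> K p0 \<longleftrightarrow> q \<in> K p0"
      using that two(1) trans sym unfolding K_def by blast
    ultimately have "colour p = colour q"
      unfolding colour_def X_def Y_def by auto
    then show ?thesis
      unfolding \<kappa>_def by simp
  qed
  moreover have "\<kappa> p = Some m" if p: "p \<in> P" "m \<in> M - Z" "E p m \<noteq> (m \<in> ?A)" for p m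
  proof -
    have "p0 \<in> K p0" "p \<in> K p"
      using two p unfolding K_def by blast+
    have "p \<notin> K p0"
    proof
      assume "p \<in> K p0"
      then have "m \<in> X1 \<union> Y1"
        using p \<open>p0 \<in> K p0\<close> unfolding X1_def Y1_def by blast
      then show False
        using p(2) unfolding Z_def by blast
    qed
    moreover have "m \<in> X p \<union> Y p"
      using p \<open>p \<in> K p\<close> unfolding X_def Y_def by blast
    ultimately have m: "colour p m"
      using p(2) unfolding colour_def by blast
    moreover have "m' = m" if "colour p m'" for m'
    proof -
      have "m' \<in> X p \<and> m \<in> X p \<or> m' \<in> Y p \<and> m \<in> Y p"
        using that m cut[OF p(1) \<open>p \<notin> K p0\<close>] unfolding colour_def Z_def by blast
      then show ?thesis
        using X_unique[OF p(1) \<open>p \<notin> K p0\<close>] Y_unique[OF p(1) \<open>p \<notin> K p0\<close>] by blast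
    qed
    ultimately have "(SOME m. colour p m) = m"
      by (rule some_equality)
    then show ?thesis
      using m unfolding \<kappa>_def by auto
  qed
  ultimately show ?thesis
    by (intro exI[of _ Z] exI[of _ ?A] exI[of _ \<kappa>]) simp
qed

section \<open>The clique separator of an extremal nonadjacent pair\<close>

locale extremal_pair = chordal_adj +
  fixes c d :: 'a and M :: "'a set"
  assumes dom: "dominating_diamonds V E"
    and cd: "c \<in> V" "d \<in> V" "c \<noteq> d" "\<not> E c d"
    and M_eq: "M = {m \<in> V. E m c \<and> E m d}"
    and max: "\<And>x y. x \<in> V \<Longrightarrow> y \<in> V \<Longrightarrow> x \<noteq> y \<Longrightarrow> \<not> E x y \<Longrightarrow> card {m \<in> V. E m x \<and> E m y} \<le> card M"
begin

lemma swap: "extremal_pair V E d c M"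
  by unfold_locales (use finite_V E_sym E_irrefl hole_free dom cd max M_eq in auto)

lemma M_sub: "M \<subseteq> V" and M_nbr: "m \<in> M \<Longrightarrow> E m c \<and> E m d \<and> E c m \<and> E d m"
  using M_eq E_sym by auto

lemma finite_M: "finite M"
  using M_sub finite_V finite_subset by blast

lemma cd_notin: "c \<notin> M" "d \<notin> M"
  using M_eq E_irrefl by auto

text \<open>Two nonadjacent vertices of \<open>M\<close> would form a \<open>C_4\<close> with
  \<open>c\<close> and \<open>d\<close>.\<close>

lemma M_clique: "x \<in> M \<Longrightarrow> y \<in> M \<Longrightarrow> x \<noteq> y \<Longrightarrow> E x y"
  using no_C4[of x c y d] M_nbr[of x] M_nbr[of y] M_sub cd by blast

lemma no_large_common_nbhd:
  assumes "x \<in> V" "y \<in> V" "x \<noteq> y" "\<not> E x y" "S \<subseteq> {m \<in> V. E m x \<and> E m y}"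
  shows "card S \<le> card M"
proof -
  have "card S \<le> card {m \<in> V. E m x \<and> E m y}"
    by (rule card_mono[OF _ assms(5)]) (use finite_V in simp)
  then show ?thesis
    using max[OF assms(1-4)] by simp
qed

text \<open>An induced path from \<open>c\<close> to \<open>d\<close> outside \<open>M\<close> has
  at least four vertices, since the middle one of three would lie in \<open>M\<close>. By
  \<open>fan_step\<close> its third vertex is adjacent to all of \<open>M\<close>, so
  \<open>c\<close> and that vertex share \<open>M\<close> and the second vertex as neighbours,
  against maximality.\<close>

lemma separated: "\<not> connected_in E (V - M) c d"
proof
  assume "connected_in E (V - M) c d"
  then obtain xs where xs: "induced_path E (V - M) c d xs"
    using induced_path_exists[of E c "V - M" d] E_sym E_irrefl cd cd_notin by blast
  define n where "n = length xs"
  have adj: "E (xs ! i) (xs ! j) \<longleftrightarrow> j = Suc i \<or> i = Suc j" if "i < n" "j < n" for i j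
    using xs that by (simp add: induced_path_def n_def)
  have ends: "xs ! 0 = c" "xs ! (n - 1) = d" "n > 0" and dist: "distinct xs"
    using xs unfolding induced_path_def n_def by auto
  have mem: "xs ! i \<in> V - M" if "i < n" for i
    using xs that nth_mem[of i xs] unfolding induced_path_def n_def by blast
  have "n \<noteq> 1" using ends cd by auto
  moreover have "n \<noteq> 2"
    using adj[of 0 1] ends cd by auto
  moreover have "n \<noteq> 3"
  proof
    assume n3: "n = 3"
    then have "E (xs ! 1) c" "E (xs ! 1) d"
      using adj[of 1 0] adj[of 1 2] ends by auto
    then show False
      using mem[of 1] n3 M_eq by auto
  qed
  ultimately have n: "n \<ge> 4" using ends(3) by linarith
  have fan: "E m (xs ! 1)" "E m (xs ! 2)" if "m \<in> M" for m
  proof -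
    have step: "E m (xs ! Suc a)" if "Suc a < n" "E m (xs ! a)" for a
      using fan_step[OF xs, of m a] that \<open>m \<in> M\<close> M_sub M_nbr[of m] unfolding n_def by blast
    show "E m (xs ! 1)"
      using step[of 0] ends M_nbr[OF that] n by simp
    then show "E m (xs ! 2)"
      using step[of 1] n by (simp add: numeral_2_eq_2)
  qed
  have n0: "0 < n" "1 < n" "2 < n"
    using n by linarith+
  have "xs ! 0 \<noteq> xs ! 2"
    using dist n0 unfolding n_def by (simp add: nth_eq_iff_index_eq)
  then have "c \<noteq> xs ! 2"
    using ends(1) by simp
  moreover have "xs ! 2 \<in> V" "xs ! 1 \<in> V" "xs ! 1 \<notin> M"
    using mem n0 by blast+
  moreover have "\<not> E c (xs ! 2)" "E (xs ! 1) c" "E (xs ! 1) (xs ! 2)"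
    using adj[of 0 2] adj[of 1 0] adj[of 1 2] n0 unfolding ends(1) by simp_all
  moreover from this have "insert (xs ! 1) M \<subseteq> {m \<in> V. E m c \<and> E m (xs ! 2)}"
    using fan M_nbr M_sub mem[OF n0(2)] by blast
  ultimately have "card (insert (xs ! 1) M) \<le> card M"
    using no_large_common_nbhd[of c "xs ! 2"] cd by blast
  then show False
    using finite_M \<open>xs ! 1 \<notin> M\<close> by simp
qed

text \<open>A diamond is connected and dominating, so \<open>c\<close> and \<open>d\<close> both
  have neighbours on it; outside \<open>M\<close> it would connect them.\<close>

lemma diamond_free_rest: "diamond_free (V - M) E"
proof (rule ccontr)
  assume "\<not> ?thesis"
  then obtain w x y z where V: "w \<in> V - M" "x \<in> V - M" "y \<in> V - M" "z \<in> V - M" and "diamond E w x y z"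
    unfolding diamond_free_def by blast
  have conn: "connected_in E (V - M) w s" "connected_in E (V - M) s w" if "s \<in> {w, x, y, z}" for s
  proof -
    have "s = w \<or> E w s"
      using that \<open>diamond E w x y z\<close> unfolding diamond_def by blast
    then show "connected_in E (V - M) w s" "connected_in E (V - M) s w"
      using connected_in_step[OF connected_in_refl, of w "V - M" s E]
        connected_in_step[OF connected_in_refl, of s "V - M" w E] that V E_sym by auto
  qed
  have "E r w \<or> E r x \<or> E r y \<or> E r z" if "r \<in> V" for r
    using dominating_diamondsD[OF dom \<open>diamond E w x y z\<close>] V that by blast
  then obtain s t where st: "s \<in> {w, x, y, z}" "t \<in> {w, x, y, z}" "E c s" "E d t"
    using cd by (metis insertCI)
  have "connected_in E (V - M) c s"
    using connected_in_step[OF connected_in_refl, of c "V - M" s E] st V cd cd_notin by auto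
  then have "connected_in E (V - M) c t"
    using conn(2)[OF st(1)] conn(1)[OF st(2)] connected_in_trans by metis
  then have "connected_in E (V - M) c d"
    using connected_in_step[of E "V - M" c t d] st V cd cd_notin E_sym by auto
  then show False
    using separated by blast
qed

lemma side_cross: "p \<in> V - M \<Longrightarrow> q \<in> V - M \<Longrightarrow> E p c \<Longrightarrow> E q d \<Longrightarrow> \<not> E p q \<and> p \<noteq> q"
  using separated connected_in_step[OF connected_in_refl, of c "V - M" p E]
    connected_in_step[of E "V - M" c p q] connected_in_step[of E "V - M" c q d] cd cd_notin E_sym
  by (metis DiffI)

lemma side_no_common_nbr:
  assumes "p \<in> V - M" "q \<in> V - M" "r \<in> V - M" "E p c" "E q d" "E p r"
  shows "\<not> E q r"
  using separated connected_in_step[OF connected_in_refl, of c "V - M" p E]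
    connected_in_step[of E "V - M" c p r] connected_in_step[of E "V - M" c r q]
    connected_in_step[of E "V - M" c q d] cd cd_notin E_sym assms
  by (metis DiffI)

text \<open>At most one vertex of \<open>M\<close> is nonadjacent to \<open>r\<close>, as
  \<open>r\<close> meets every diamond with tips \<open>c\<close>, \<open>d\<close>, and at most one
  vertex outside \<open>M\<close> is adjacent to \<open>r\<close> and to \<open>c\<close> or
  \<open>d\<close>. Deleting both leaves \<open>?A\<close> as an almost complete clique in the sense
  of \<open>near_complete_layout_width\<close>.\<close>

lemma remote_layout_width:
  assumes r: "r \<in> V - M" "r \<noteq> c" "r \<noteq> d" "\<not> E r c" "\<not> E r d"
  shows "layout_width_le 144 V E"
proof -
  let ?A = "{m \<in> M. E m r}"
  let ?X = "{x \<in> V - M. E x r \<and> (E x c \<or> E x d)}"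
  let ?V = "V - ((M - ?A) \<union> ?X)"
  have "m = m'" if "m \<in> M - ?A" "m' \<in> M - ?A" for m m'
  proof (rule ccontr)
    assume "m \<noteq> m'"
    then have "diamond E m m' c d"
      using that M_nbr[of m] M_nbr[of m'] M_clique[of m m'] cd unfolding diamond_def by blast
    then show False
      using dominating_diamondsD[OF dom, of m m' c d r] that r cd M_sub E_sym by blast
  qed
  note card_MA = subsingleton_card[of "M - ?A", OF this]
  have same_side: "x = y" if e: "e = c \<or> e = d" and x: "x \<in> ?X" "E x e" and y: "y \<in> ?X" "E y e" for x y e
  proof (rule ccontr)
    assume "x \<noteq> y"
    \<comment> \<open>\<open>?A\<close> lacks at most one vertex of \<open>M\<close>, so two further
      common neighbours would exceed the maximum.\<close>
    have "?A \<union> {x, y} \<subseteq> {m \<in> V. E m r \<and> E m e}"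
      using e x y M_nbr M_sub by blast
    then have "card (?A \<union> {x, y}) \<le> card M"
      using no_large_common_nbhd[of r e] e r cd by blast
    moreover have "card (?A \<union> {x, y}) = card ?A + 2"
      using x y \<open>x \<noteq> y\<close> finite_M by (subst card_Un_disjoint) auto
    moreover have "card M = card ?A + card (M - ?A)"
      using finite_M card_Diff_subset[of ?A M] card_mono[of M ?A] by auto
    ultimately show False
      using card_MA(2) by linarith
  qed
  have "x = y" if "x \<in> ?X" "y \<in> ?X" for x y
    using that same_side[of c x y] same_side[of d x y] side_no_common_nbr[of x y r]
      side_no_common_nbr[of y x r] r(1) by blast
  note card_X = subsingleton_card[of ?X, OF this]
  interpret W: chordal_adj ?V E
    by (rule chordal_adj_subset) blast
  have "layout_width_le 36 ?V E"
  proof (rule W.near_complete_layout_width[of ?A])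
    show "?A \<subseteq> ?V"
      using M_sub by blast
    show "E x y" if "x \<in> ?A" "y \<in> ?A" "x \<noteq> y" for x y
      using that M_clique by blast
    show "dominating_diamonds ?V E"
      by (rule dominating_diamonds_subset[OF dom]) blast
    show "diamond_free (?V - ?A) E"
      by (rule diamond_free_subset[OF diamond_free_rest]) blast
    fix x m m' assume x: "x \<in> ?V - ?A" and m: "m \<in> ?A" "m' \<in> ?A" "\<not> E x m" "\<not> E x m'"
    show "m = m'"
    proof (rule ccontr)
      assume ne: "m \<noteq> m'"
      \<comment> \<open>The vertices \<open>c\<close>, \<open>d\<close>, \<open>r\<close> are
        pairwise nonadjacent, and any two of them are tips of a diamond with \<open>m\<close>,
        \<open>m'\<close>. So \<open>x\<close> is adjacent to two of the three, which the definition
        of \<open>M\<close> and the deletion of \<open>?X\<close> exclude.\<close>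
      have tip: False if "e \<in> V" "e' \<in> V" "e \<noteq> e'" "\<not> E e e'" "E m e" "E m e'" "E m' e" "E m' e'"
        "\<not> E x e" "\<not> E x e'" for e e'
      proof -
        have "diamond E m m' e e'"
          using that ne m M_clique[of m m'] unfolding diamond_def by blast
        then show False
          using dominating_diamondsD[OF dom, of m m' e e' x] that m x M_sub by blast
      qed
      have xV: "x \<in> V - M" "\<not> (E x c \<and> E x d)" "E x c \<or> E x d \<longrightarrow> \<not> E x r"
        using x M_eq by blast+
      have mm: "E m c" "E m d" "E m r" "E m' c" "E m' d" "E m' r"
        using m M_nbr by blast+
      show False
        using tip[of c d] tip[of r d] tip[of r c] xV mm r cd by blast
    qed
  qed
  moreover have "finite ((M - ?A) \<union> ?X)"
    using card_MA(1) card_X(1) by (rule finite_UnI)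
  moreover have "card ((M - ?A) \<union> ?X) \<le> 2"
    using card_Un_le[of "M - ?A" ?X] card_MA(2) card_X(2) by linarith
  ultimately have "layout_width_le (36 * 2 ^ 2) V E"
    by (intro layout_width_le_delete[where Z = "(M - ?A) \<union> ?X"]) auto
  then show ?thesis by simp
qed

section \<open>The two sides of the separator\<close>

definition P where "P = {p \<in> V - M. E p c}"
definition Q where "Q = {q \<in> V - M. E q d}"

lemma M_iff: "m \<in> M \<longleftrightarrow> m \<in> V \<and> E m c \<and> E m d"
  unfolding M_eq by blast

lemma P_facts: "p \<in> P \<Longrightarrow> p \<in> V \<and> p \<notin> M \<and> p \<noteq> c \<and> p \<noteq> d \<and> E p c \<and> E c p \<and> \<not> E p d \<and> \<not> E d p"
  using E_sym E_irrefl cd by (auto simp: P_def M_iff)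

lemma Q_facts: "q \<in> Q \<Longrightarrow> q \<in> V \<and> q \<notin> M \<and> q \<noteq> c \<and> q \<noteq> d \<and> E q d \<and> E d q \<and> \<not> E q c \<and> \<not> E c q"
  using E_sym E_irrefl cd by (auto simp: Q_def M_iff)

text \<open>An induced path in \<open>P\<close> forms a diamond with \<open>c\<close>, and
  \<open>d\<close> is adjacent to none of its vertices.\<close>

lemma P_trans:
  assumes "p \<in> P" "q \<in> P" "r \<in> P" "E p q" "E q r" "p \<noteq> r"
  shows "E p r"
proof (rule ccontr)
  assume "\<not> E p r"
  then have "diamond E c q p r"
    using assms P_facts[of p] P_facts[of q] P_facts[of r] E_sym[of p q] unfolding diamond_def by blast
  then have "E d c \<or> E d q \<or> E d p \<or> E d r"
    using assms P_facts cd by (intro dominating_diamondsD[OF dom]) auto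
  then show False
    using P_facts[of p] P_facts[of q] P_facts[of r] assms cd E_sym[of d c] by blast
qed

text \<open>Otherwise \<open>p\<close>, \<open>m\<close>, \<open>m'\<close>, \<open>q\<close> would
  be an induced \<open>C_4\<close>.\<close>

lemma P_nested:
  assumes "p \<in> P" "q \<in> P" "E p q" "m \<in> M" "m' \<in> M" "E p m" "\<not> E q m" "E q m'"
  shows "E p m'"
proof -
  have "m \<noteq> m'" "p \<in> V" "q \<in> V" "p \<noteq> m'" "m \<noteq> q" "m \<in> V" "m' \<in> V"
    using assms M_sub P_facts[of p] P_facts[of q] by blast+
  then show ?thesis
    using no_C4[of p m m' q] M_clique[of m m'] assms E_sym[of p q] E_sym[of q m'] E_sym[of m q] by blast
qed

text \<open>Distinct \<open>m\<close>, \<open>m'\<close> form a diamond with tips \<open>p\<close>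
  and \<open>d\<close> that \<open>q\<close> fails to meet.\<close>

lemma P_near:
  assumes "p \<in> P" "q \<in> P" "p \<noteq> q" "\<not> E p q" "m \<in> M" "m' \<in> M" "E p m" "E p m'" "\<not> E q m" "\<not> E q m'"
  shows "m = m'"
proof (rule ccontr)
  assume "m \<noteq> m'"
  then have "diamond E m m' p d"
    using assms M_clique[of m m'] M_nbr[of m] M_nbr[of m'] P_facts[of p] E_sym[of p m] E_sym[of p m']
    unfolding diamond_def by blast
  then have "E q m \<or> E q m' \<or> E q p \<or> E q d"
    using assms P_facts cd M_sub by (intro dominating_diamondsD[OF dom]) auto
  then show False
    using assms P_facts[of q] E_sym[of q p] by blast
qed

lemma PQ_cross: "p \<in> P \<Longrightarrow> q \<in> Q \<Longrightarrow> \<not> E p q \<and> p \<noteq> q"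
  using side_cross unfolding P_def Q_def by blast

text \<open>In the diamond formed by \<open>c\<close>, \<open>p\<close> with tips \<open>m\<close>,
  \<open>p'\<close>, a vertex of \<open>Q\<close> can be adjacent only to \<open>m\<close>.\<close>

lemma P_split:
  assumes "p \<in> P" "p' \<in> P" "E p p'" "m \<in> M" "E p m" "\<not> E p' m" "q \<in> Q"
  shows "E q m"
proof -
  have "diamond E c p m p'"
    using assms M_nbr[of m] P_facts[of p] P_facts[of p'] E_sym[of m p'] unfolding diamond_def by blast
  then have "E q c \<or> E q p \<or> E q m \<or> E q p'"
    using assms P_facts Q_facts M_sub cd by (intro dominating_diamondsD[OF dom]) auto
  moreover have "\<not> E q c"
    using Q_facts[OF assms(7)] by blast
  moreover have "\<not> E q p" "\<not> E q p'"
    using PQ_cross[of p q] PQ_cross[of p' q] assms E_sym by blast+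
  ultimately show ?thesis by blast
qed

lemma P_chain:
  assumes "\<And>p p'. p \<in> P \<Longrightarrow> p' \<in> P \<Longrightarrow> p \<noteq> p' \<Longrightarrow> E p p'" and "N \<subseteq> M"
  shows "layout_width_le 5 (P \<union> N) E"
proof (rule chain_layout_width[OF _ _ _ E_sym])
  show "finite P" "finite N" "P \<inter> N = {}"
    using finite_V finite_M finite_subset[OF assms(2)] assms(2) unfolding P_def by auto
  show "E x y" if "x \<in> N" "y \<in> N" "x \<noteq> y" for x y
    using that assms(2) M_clique by blast
  show "{m \<in> N. E p m} \<subseteq> {m \<in> N. E q m} \<or> {m \<in> N. E q m} \<subseteq> {m \<in> N. E p m}"
    if pq: "p \<in> P" "q \<in> P" for p q
  proof (rule ccontr)
    assume not: "\<not> ?thesis"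
    then obtain m m' where "m \<in> N" "m' \<in> N" "E p m" "\<not> E q m" "E q m'" "\<not> E p m'"
      by blast
    moreover from this have "E p q"
      using assms(1)[OF pq] by blast
    ultimately show False
      using P_nested[OF pq, of m m'] assms(2) by blast
  qed
qed (use assms(1) in blast)+

lemma P_colouring:
  assumes "p0 \<in> P" "p1 \<in> P" "p0 \<noteq> p1" "\<not> E p0 p1"
  shows "\<exists>Z A (\<kappa> :: 'a \<Rightarrow> 'a option). finite Z \<and> card Z \<le> 4 \<and> (\<forall>p\<in>P. \<forall>q\<in>P. E p q \<longrightarrow> \<kappa> p = \<kappa> q) \<and>
    (\<forall>p\<in>P. \<forall>m\<in>M - Z. E p m \<noteq> (m \<in> A) \<longrightarrow> \<kappa> p = Some m)"
  by (rule clique_family_colouring[where E = E and P = P and M = M,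
        OF E_sym P_trans P_nested P_near assms])

text \<open>Two nonadjacent vertices of \<open>P\<close>, if there are any, serve as references for
  the colouring. Its pattern needs one bit, membership in \<open>A\<close>, and four deletions give
  \<open>17 * 2 ^ 4 = 272\<close>.\<close>

lemma P_side_layout_width:
  assumes "N \<subseteq> M"
  shows "layout_width_le 272 (P \<union> N) E"
proof (cases "\<forall>p\<in>P. \<forall>p'\<in>P. p \<noteq> p' \<longrightarrow> E p p'")
  case True
  then have "layout_width_le 5 (P \<union> N) E"
    using P_chain assms by blast
  then show ?thesis
    by (rule layout_width_le_mono) simp
next
  case False
  then obtain p0 p1 where "p0 \<in> P" "p1 \<in> P" "p0 \<noteq> p1" "\<not> E p0 p1"
    by blast
  from P_colouring[OF this] obtain Z A and \<kappa> :: "'a \<Rightarrow> 'a option"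
    where Z: "finite Z" "card Z \<le> 4" and const: "\<forall>p\<in>P. \<forall>q\<in>P. E p q \<longrightarrow> \<kappa> p = \<kappa> q"
      and cross: "\<forall>p\<in>P. \<forall>m\<in>M - Z. E p m \<noteq> (m \<in> A) \<longrightarrow> \<kappa> p = Some m"
    by (elim exE conjE)
  let ?V = "P \<union> N - Z"
  interpret W: chordal_adj ?V E
    by (rule chordal_adj_subset) (use assms M_sub in \<open>auto simp: P_def\<close>)
  have rest: "?V - (N - Z) \<subseteq> P"
    by blast
  have "layout_width_le (8 * card (UNIV :: bool set) + 1) ?V E"
  proof (rule W.coloured_layout_width[where N = "N - Z" and \<kappa> = \<kappa> and f = "\<lambda>x. x \<in> A" and D = "\<lambda>_ b. b"])
    show "diamond_free (?V - (N - Z)) E"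
      by (rule diamond_free_subset[OF diamond_free_rest]) (use rest in \<open>auto simp: P_def\<close>)
    show "E x y" if "x \<in> N - Z" "y \<in> N - Z" "x \<noteq> y" for x y
      using that assms M_clique by blast
    show "\<kappa> x = \<kappa> y" if "x \<in> ?V - (N - Z)" "y \<in> ?V - (N - Z)" "E x y" for x y
      using that const rest by blast
    show "\<kappa> x = Some m" if "x \<in> ?V - (N - Z)" "m \<in> N - Z" "E x m \<noteq> (m \<in> A)" for x m
      using that cross rest assms by blast
  qed blast
  then have "layout_width_le (17 * 2 ^ 4) (P \<union> N) E"
    by (intro layout_width_le_delete[OF _ Z]) auto
  then show ?thesis by simp
qed

text \<open>The situation is symmetric in \<open>c\<close> and \<open>d\<close>, so every fact about
  \<open>P\<close> becomes one about \<open>Q\<close>.\<close>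

interpretation sw: extremal_pair V E d c M
  by (rule swap)

lemma sw_sides: "sw.P = Q" "sw.Q = P"
  unfolding sw.P_def sw.Q_def P_def Q_def by blast+

text \<open>The part \<open>?MA\<close> of \<open>M\<close> complete to \<open>P\<close> is laid out
  with \<open>Q\<close>, the rest with \<open>P\<close>. Between the two halves, vertices of
  \<open>?MA\<close> see everything and \<open>Q\<close> sees nothing of \<open>P\<close>, while
  each vertex of \<open>?MB\<close> is complete to \<open>Q\<close> or has no neighbour there; so
  two bits per vertex determine the edges.\<close>

lemma clique_side_layout_width:
  assumes all: "V - {c, d} = M \<union> P \<union> Q"
    and Q_clique: "\<And>q q'. q \<in> Q \<Longrightarrow> q' \<in> Q \<Longrightarrow> q \<noteq> q' \<Longrightarrow> E q q'"
  shows "layout_width_le (65 * 2 ^ 10) V E"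
proof -
  let ?MA = "{m \<in> M. \<forall>p\<in>P. E p m}"
  let ?MB = "M - ?MA"
  have disj: "P \<inter> M = {}" "Q \<inter> M = {}" "P \<inter> Q = {}"
    using PQ_cross unfolding P_def Q_def by blast+
  have fin: "finite P" "finite Q"
    using finite_V unfolding P_def Q_def by simp_all
  have "layout_width_le 5 (Q \<union> ?MA) E"
    using sw.P_chain[of ?MA] Q_clique unfolding sw_sides by blast
  then have left: "layout_width_le 272 (Q \<union> ?MA) E"
    by (rule layout_width_le_mono) simp
  have right: "layout_width_le 272 (P \<union> ?MB) E"
    by (rule P_side_layout_width) blast
  have "layout_width_le (2 * card (UNIV :: (bool \<times> bool) set) * 272 + 1) ((Q \<union> ?MA) \<union> (P \<union> ?MB)) E"
  proof (rule layout_width_le_join[OF left right, where f = "\<lambda>x. (x \<in> M, x \<in> M \<and> (\<exists>q\<in>Q. E q x))"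
        and D = "\<lambda>a b. fst a \<or> snd b"])
    fix x y assume x: "x \<in> Q \<union> ?MA" and y: "y \<in> P \<union> ?MB"
    have "E x y \<longleftrightarrow> x \<in> M \<or> y \<in> M \<and> (\<exists>q\<in>Q. E q y)"
    proof (cases "x \<in> M")
      case True
      then have "x \<in> ?MA" using x disj by blast
      then show ?thesis
        using y M_clique[of x y] E_sym[of y x] by blast
    next
      case False
      then have xQ: "x \<in> Q" using x by blast
      show ?thesis
      proof (cases "y \<in> M")
        case True
        then obtain p where p: "p \<in> P" "\<not> E p y" using y disj by blast
        \<comment> \<open>If \<open>y\<close> split the clique \<open>Q\<close>, then
          \<open>P_split\<close> with the sides exchanged would make it adjacent to
          \<open>p\<close>.\<close>
        have "E x y" if "q \<in> Q" "E q y" for q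
        proof (rule ccontr)
          assume "\<not> E x y"
          then have "E q x"
            using Q_clique[of q x] that xQ by blast
          then show False
            using sw.P_split[of q x y p] that xQ p True \<open>\<not> E x y\<close> unfolding sw_sides by blast
        qed
        then show ?thesis
          using True False xQ by blast
      next
        case False
        then show ?thesis
          using y PQ_cross[of y x] xQ \<open>x \<notin> M\<close> E_sym by blast
      qed
    qed
    then show "E x y = (fst (x \<in> M, x \<in> M \<and> (\<exists>q\<in>Q. E q x)) \<or> snd (y \<in> M, y \<in> M \<and> (\<exists>q\<in>Q. E q y)))"
      by simp
  qed (use disj fin finite_M E_sym in auto)
  moreover have "(Q \<union> ?MA) \<union> (P \<union> ?MB) = V - {c, d}"
    unfolding all by blast
  moreover have "card (UNIV :: (bool \<times> bool) set) = 4"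
    by (simp add: card_cartesian_product flip: UNIV_Times_UNIV)
  ultimately have "layout_width_le 2177 (V - {c, d}) E"
    by simp
  then have "layout_width_le (2177 * 2 ^ 2) V E"
    by (rule layout_width_le_delete) (auto simp: card_insert_if)
  then show ?thesis
    by (rule layout_width_le_mono) simp
qed

text \<open>Both sides are coloured independently, which is consistent because no edge joins
  \<open>P\<close> to \<open>Q\<close>. Three bits select the side and the patterns
  \<open>A\<close>, \<open>B\<close>, giving \<open>8 * 8 + 1 = 65\<close>; the ten deletions are
  \<open>c\<close>, \<open>d\<close> and at most four vertices for each side.\<close>

lemma coloured_sides_layout_width:
  assumes all: "V - {c, d} = M \<union> P \<union> Q"
    and p: "p0 \<in> P" "p1 \<in> P" "p0 \<noteq> p1" "\<not> E p0 p1"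
    and q: "q0 \<in> Q" "q1 \<in> Q" "q0 \<noteq> q1" "\<not> E q0 q1"
  shows "layout_width_le (65 * 2 ^ 10) V E"
proof -
  from P_colouring[OF p] obtain Y A and \<kappa> :: "'a \<Rightarrow> 'a option"
    where Y: "finite Y" "card Y \<le> 4" and const: "\<forall>p\<in>P. \<forall>q\<in>P. E p q \<longrightarrow> \<kappa> p = \<kappa> q"
      and cross: "\<forall>p\<in>P. \<forall>m\<in>M - Y. E p m \<noteq> (m \<in> A) \<longrightarrow> \<kappa> p = Some m"
    by (elim exE conjE)
  from sw.P_colouring[unfolded sw_sides, OF q] obtain Z B and \<kappa>' :: "'a \<Rightarrow> 'a option"
    where Z: "finite Z" "card Z \<le> 4" and const': "\<forall>p\<in>Q. \<forall>q\<in>Q. E p q \<longrightarrow> \<kappa>' p = \<kappa>' q"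
      and cross': "\<forall>p\<in>Q. \<forall>m\<in>M - Z. E p m \<noteq> (m \<in> B) \<longrightarrow> \<kappa>' p = Some m"
    by (elim exE conjE)
  let ?Z = "{c, d} \<union> (Y \<union> Z)"
  let ?V = "V - ?Z"
  let ?N = "M - ?Z"
  let ?k = "\<lambda>x. if x \<in> P then \<kappa> x else \<kappa>' x"
  have rest: "?V - ?N \<subseteq> P \<union> Q"
    using all by blast
  interpret W: chordal_adj ?V E
    by (rule chordal_adj_subset) blast
  have "layout_width_le (8 * card (UNIV :: (bool \<times> bool \<times> bool) set) + 1) ?V E"
  proof (rule W.coloured_layout_width[where N = ?N and \<kappa> = ?k and f = "\<lambda>x. (x \<in> P, x \<in> A, x \<in> B)"
        and D = "\<lambda>a b. if fst a then fst (snd b) else snd (snd b)"])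
    show "?N \<subseteq> ?V"
      using M_sub by blast
    show "diamond_free (?V - ?N) E"
      by (rule diamond_free_subset[OF diamond_free_rest]) blast
    show "E x y" if "x \<in> ?N" "y \<in> ?N" "x \<noteq> y" for x y
      using that M_clique by blast
    show "?k x = ?k y" if xy: "x \<in> ?V - ?N" "y \<in> ?V - ?N" "E x y" for x y
    proof (cases "x \<in> P")
      case True
      then have "y \<in> P"
        using PQ_cross[of x y] xy rest by blast
      then show ?thesis
        using True const xy(3) by simp
    next
      case False
      then have "x \<in> Q" using xy rest by blast
      then have "y \<in> Q" "y \<notin> P"
        using PQ_cross[of y x] PQ_cross[of y y] xy rest E_sym by blast+
      then show ?thesis
        using False \<open>x \<in> Q\<close> const' xy(3) by simp
    qed
    show "?k x = Some m"
      if x: "x \<in> ?V - ?N" "m \<in> ?N" "E x m \<noteq> (if fst (x \<in> P, x \<in> A, x \<in> B) then fst (snd (m \<in> P, m \<in> A, m \<in> B))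
        else snd (snd (m \<in> P, m \<in> A, m \<in> B)))" for x m
    proof (cases "x \<in> P")
      case True
      then show ?thesis
        using cross x by auto
    next
      case False
      then have "x \<in> Q" using x rest by blast
      then show ?thesis
        using cross' x False by auto
    qed
  qed
  moreover have "card (UNIV :: (bool \<times> bool \<times> bool) set) = 8"
    by (simp add: card_cartesian_product flip: UNIV_Times_UNIV)
  ultimately have "layout_width_le 65 ?V E"
    by simp
  moreover have "card ?Z \<le> 10"
    using card_Un_le[of "{c, d}" "Y \<union> Z"] card_Un_le[of Y Z] Y Z cd(3) by simp
  ultimately show ?thesis
    using Y Z by (intro layout_width_le_delete[where Z = ?Z]) auto
qed

lemma extremal_pair_layout_width: "layout_width_le (65 * 2 ^ 10) V E"
proof (cases "\<exists>r\<in>V - M. r \<noteq> c \<and> r \<noteq> d \<and> \<not> E r c \<and> \<not> E r d")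
  case True
  then obtain r where "r \<in> V - M" "r \<noteq> c" "r \<noteq> d" "\<not> E r c" "\<not> E r d"
    by blast
  from remote_layout_width[OF this] show ?thesis
    by (rule layout_width_le_mono) simp
next
  case False
  have all: "V - {c, d} = M \<union> P \<union> Q"
    using False M_sub cd_notin cd E_irrefl E_sym unfolding P_def Q_def by blast
  consider "\<forall>q\<in>Q. \<forall>q'\<in>Q. q \<noteq> q' \<longrightarrow> E q q'" | "\<forall>p\<in>P. \<forall>p'\<in>P. p \<noteq> p' \<longrightarrow> E p p'"
    | p0 p1 q0 q1 where "p0 \<in> P" "p1 \<in> P" "p0 \<noteq> p1" "\<not> E p0 p1" "q0 \<in> Q" "q1 \<in> Q" "q0 \<noteq> q1" "\<not> E q0 q1"
    by blast
  then show ?thesis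
  proof cases
    case 1
    then show ?thesis
      using clique_side_layout_width[OF all] by blast
  next
    case 2
    have "V - {d, c} = M \<union> Q \<union> P"
      using all by blast
    then show ?thesis
      using extremal_pair.clique_side_layout_width[OF swap, unfolded sw_sides] 2 by blast
  next
    case 3
    then show ?thesis
      by (rule coloured_sides_layout_width[OF all])
  qed
qed

end

section \<open>From an extremal pair to the class of graphs\<close>

lemma (in chordal_adj) dominating_diamonds_layout_width:
  assumes dom: "dominating_diamonds V E"
  shows "layout_width_le (65 * 2 ^ 10) V E"
proof (cases "\<forall>x\<in>V. \<forall>y\<in>V. x \<noteq> y \<longrightarrow> E x y")
  case True
  then have "diamond_free V E"
    unfolding diamond_free_def diamond_def by blast
  from diamond_free_layout_width[OF this] show ?thesis
    by (rule layout_width_le_mono) simp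
next
  case False
  let ?R = "\<lambda>p. fst p \<in> V \<and> snd p \<in> V \<and> fst p \<noteq> snd p \<and> \<not> E (fst p) (snd p)"
  let ?n = "\<lambda>p. card {m \<in> V. E m (fst p) \<and> E m (snd p)}"
  from False obtain x y where "?R (x, y)" by auto
  \<comment> \<open>The number of common neighbours is bounded, so a pair attaining the maximum
    exists.\<close>
  moreover have "\<forall>p. ?R p \<longrightarrow> ?n p < Suc (card V)"
    using finite_V by (auto intro!: le_imp_less_Suc card_mono)
  ultimately obtain p where p: "?R p" "\<forall>q. ?R q \<longrightarrow> ?n q \<le> ?n p"
    using Lattices_Big.ex_has_greatest_nat[of ?R "(x, y)" ?n] by blast
  interpret extremal_pair V E "fst p" "snd p" "{m \<in> V. E m (fst p) \<and> E m (snd p)}"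
  proof
    show "card {m \<in> V. E m x \<and> E m y} \<le> ?n p" if "x \<in> V" "y \<in> V" "x \<noteq> y" "\<not> E x y" for x y
      using p(2)[rule_format, of "(x, y)"] that by simp
  qed (use p(1) dom in auto)
  show ?thesis
    by (rule extremal_pair_layout_width)
qed

lemma chordal_hole_free:
  assumes "pair_graph G" "chordal G"
  shows "hole_free (pverts G) (\<lambda>u v. (u, v) \<in> parcs G)"
  unfolding hole_free_def
proof (intro allI impI notI)
  fix n :: nat
  assume n: "4 \<le> n" and "\<exists>f. inj_on f {..<n} \<and> f ` {..<n} \<subseteq> pverts G \<and>
    (\<forall>i<n. \<forall>j<n. ((f i, f j) \<in> parcs G) = (j = Suc i mod n \<or> i = Suc j mod n))"
  then obtain f where "inj_on f (pverts (cycle_graph n))" "f ` pverts (cycle_graph n) \<subseteq> pverts G"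
    "\<forall>u\<in>pverts (cycle_graph n). \<forall>v\<in>pverts (cycle_graph n).
      (f u, f v) \<in> parcs G \<longleftrightarrow> (u, v) \<in> parcs (cycle_graph n)"
    by (auto simp: cycle_graph_def)
  moreover have "H_free (cycle_graph n) G"
    using assms(2) n by (simp add: chordal_def)
  moreover have "pair_graph (cycle_graph n)"
    using n by (intro pair_graph_cycle_graph) simp
  ultimately show False
    unfolding H_free_iff_embedding[OF assms(1) \<open>pair_graph (cycle_graph n)\<close>] by blast
qed

lemma diamond_plus_vertex_free_dominating:
  assumes G: "pair_graph G"
    and free: "H_free (path_graph 1 +\<^sub>G
      complement_graph (path_graph 1 +\<^sub>G path_graph 1 +\<^sub>G path_graph 2)) G"
  shows "dominating_diamonds (pverts G) (\<lambda>u v. (u, v) \<in> parcs G)"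
  unfolding dominating_diamonds_def
proof (intro ballI impI)
  fix a b c d r
  assume V: "a \<in> pverts G" "b \<in> pverts G" "c \<in> pverts G" "d \<in> pverts G" "r \<in> pverts G"
    and D: "diamond (\<lambda>u v. (u, v) \<in> parcs G) a b c d"
  have sym: "(u, v) \<in> parcs G \<longleftrightarrow> (v, u) \<in> parcs G" and irrefl: "(u, u) \<notin> parcs G" for u v
    using G by (auto simp: pair_graph_iff sym_def irrefl_def)
  show "(r, a) \<in> parcs G \<or> (r, b) \<in> parcs G \<or> (r, c) \<in> parcs G \<or> (r, d) \<in> parcs G"
  proof (rule ccontr)
    assume none: "\<not> ?thesis"
    let ?H = "path_graph 1 +\<^sub>G complement_graph (path_graph 1 +\<^sub>G path_graph 1 +\<^sub>G path_graph 2)"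
    \<comment> \<open>In the complement only the two ends of \<open>path_graph 2\<close> are
      nonadjacent, so they become the tips \<open>c\<close>, \<open>d\<close>; the two single
      vertices become \<open>a\<close>, \<open>b\<close>.\<close>
    let ?f = "case_sum (\<lambda>_. r) (case_sum (case_sum (\<lambda>_. a) (\<lambda>_. b)) (\<lambda>i. if i = (0::nat) then c else d))"
    have H: "pair_graph ?H"
      by (intro pair_graph_disjoint_union pair_graph_complement_graph pair_graph_path_graph)
    have two: "{..<2} = {0, 1 :: nat}" by auto
    have verts: "pverts ?H = {Inl 0, Inr (Inl (Inl 0)), Inr (Inl (Inr 0)), Inr (Inr 0), Inr (Inr 1)}"
      by (auto simp: disjoint_union_def complement_graph_def path_graph_def two)
    have edges: "(Inl x, Inl y) \<in> parcs (K +\<^sub>G L) \<longleftrightarrow> (x, y) \<in> parcs K"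
      "(Inr x', Inr y') \<in> parcs (K +\<^sub>G L) \<longleftrightarrow> (x', y') \<in> parcs L"
      "(Inl x, Inr y') \<notin> parcs (K +\<^sub>G L)" "(Inr x', Inl y) \<notin> parcs (K +\<^sub>G L)"
      for x y x' y' and K :: "'x pair_pre_digraph" and L :: "'y pair_pre_digraph"
      by (auto simp: disjoint_union_def)
    have adj: "(?f u, ?f v) \<in> parcs G \<longleftrightarrow> (u, v) \<in> parcs ?H" if "u \<in> pverts ?H" "v \<in> pverts ?H" for u v
      using that D none irrefl sym unfolding verts diamond_def
      by (auto simp: edges complement_graph_def) (auto simp: path_graph_def disjoint_union_def)
    have "inj_on ?f (pverts ?H)"
      using D none irrefl sym unfolding verts diamond_def inj_on_def by auto
    moreover have "?f ` pverts ?H \<subseteq> pverts G"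
      using V unfolding verts by auto
    ultimately show False
      using free adj unfolding H_free_iff_embedding[OF G H] by blast
  qed
qed

theorem theorem5:
  shows "bounded_clique_width
    {G :: 'a pair_pre_digraph. pair_graph G \<and> chordal G \<and>
       H_free (path_graph 1 +\<^sub>G
         complement_graph (path_graph 1 +\<^sub>G path_graph 1 +\<^sub>G path_graph 2)) G}"
  unfolding bounded_clique_width_def
proof (intro exI ballI)
  fix G :: "'a pair_pre_digraph"
  assume "G \<in> {G. pair_graph G \<and> chordal G \<and> H_free (path_graph 1 +\<^sub>G
    complement_graph (path_graph 1 +\<^sub>G path_graph 1 +\<^sub>G path_graph 2)) G}"
  then have G: "pair_graph G" "chordal G" "H_free (path_graph 1 +\<^sub>G
    complement_graph (path_graph 1 +\<^sub>G path_graph 1 +\<^sub>G path_graph 2)) G"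
    by auto
  interpret chordal_adj "pverts G" "\<lambda>u v. (u, v) \<in> parcs G"
    using G(1) chordal_hole_free[OF G(1,2)] by unfold_locales (auto simp: pair_graph_iff sym_def irrefl_def)
  show "clique_width G \<le> 3 * (65 * 2 ^ 10)"
    by (intro clique_width_le_layout_width G(1) dominating_diamonds_layout_width
        diamond_plus_vertex_free_dominating G(3))
qed

end
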